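(* Let $t\ge 1$ be an integer, let $N=\max\{1.27\times 10^7,\ 6.5025\times 2^{2t+1}\}$, and let $n$ be an integer with $n\ge N+\frac32+3\sqrt{N-\frac74}$. Then the following graph $M_t$ is (up to isomorphism) the extremal graph for $\mathrm{spex}_{\mathcal{OP}}(n,(t+1)K_2)$, i.e. the unique $n$-vertex $(t+1)K_2$-free outerplanar graph with spectral radius equal to $\mathrm{spex}_{\mathcal{OP}}(n,(t+1)K_2)$: (i) if $t=1$, $M_t\cong K_{1,n-1}$; (ii) if $t\ge 2$, $M_t\cong K_1\vee H_{\mathcal{OP}}(2t-1,1)$.
   Context: All graphs are finite and simple. The spectral radius of a graph is the maximum modulus of the eigenvalues of its adjacency matrix. A graph is $F$-free if it does not contain $F$ as a (not necessarily induced) subgraph. $\mathrm{spex}_{\mathcal{OP}}(n,F)$ is the maximum spectral radius over all $n$-vertex $F$-free outerplanar graphs (not required to be connected). $(t+1)K_2$ is the disjoint union of $t+1$ copies of $K_2$. $G_1\vee G_2$ is the join, $\cup$ is disjoint union, $mH$ is the disjoint union of $m$ copies of $H$, and $P_k$ is the path on $k$ vertices. For positive integers $n,n_1,n_2$ with $n-1\ge n_1>n_2\ge 1$, $H_{\mathcal{OP}}(n_1,n_2)$ is the following graph on $n-1$ vertices: $$H_{\mathcal{OP}}(n_1,n_2)=\begin{cases}P_{n_1}\cup \frac{n-1-n_1}{n_2}P_{n_2}, & \text{if } n_2\mid (n-1-n_1);\\[2pt] P_{n_1}\cup\left\lfloor\frac{n-1-n_1}{n_2}\right\rfloor P_{n_2}\cup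 P_{n-1-n_1-\lfloor\frac{n-1-n_1}{n_2}\rfloor n_2}, & \text{otherwise.}\end{cases}$$ In particular $H_{\mathcal{OP}}(2t-1,1)=P_{2t-1}\cup(n-2t)K_1$. *)

theory Defs
  imports
    "HOL-Analysis.Path_Connected"
    "Jordan_Normal_Form.Spectral_Radius"
begin

(* Graphs on n vertices are labelled: the vertex set is always {..<n}. *)
record graph =
  nverts :: nat
  edges :: "nat set set"

definition simple_graph :: "graph \<Rightarrow> bool" where
  "simple_graph G \<longleftrightarrow> (\<forall>e\<in>edges G. e \<subseteq> {..<nverts G} \<and> card e = 2)"

definition graph_iso :: "graph \<Rightarrow> graph \<Rightarrow> bool" where
  "graph_iso G H \<longleftrightarrow>
     (\<exists>f. bij_betw f {..<nverts G} {..<nverts H} \<and>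
          (\<forall>u<nverts G. \<forall>v<nverts G. {u, v} \<in> edges G \<longleftrightarrow> {f u, f v} \<in> edges H))"

definition has_subgraph :: "graph \<Rightarrow> graph \<Rightarrow> bool" where
  "has_subgraph G F \<longleftrightarrow>
     (\<exists>f. inj_on f {..<nverts F} \<and> f ` {..<nverts F} \<subseteq> {..<nverts G} \<and>
          (\<forall>e\<in>edges F. f ` e \<in> edges G))"

definition graph_free :: "graph \<Rightarrow> graph \<Rightarrow> bool" where
  "graph_free F G \<longleftrightarrow> \<not> has_subgraph G F"

definition path_graph :: "nat \<Rightarrow> graph" where
  "path_graph k = \<lparr>nverts = k, edges = {{i, Suc i} | i. Suc i < k}\<rparr>"

definition complete_graph :: "nat \<Rightarrow> graph" where
  "complete_graph k = \<lparr>nverts = k, edges = {{i, j} | i j. i < j \<and> j < k}\<rparr>"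

definition complete_bipartite :: "nat \<Rightarrow> nat \<Rightarrow> graph" where
  "complete_bipartite a b =
     \<lparr>nverts = a + b, edges = {{i, a + j} | i j. i < a \<and> j < b}\<rparr>"

(* Disjointness is achieved by shifting the labels of the second graph. *)
definition disjoint_union :: "graph \<Rightarrow> graph \<Rightarrow> graph" where
  "disjoint_union G H =
     \<lparr>nverts = nverts G + nverts H,
      edges = edges G \<union> (\<lambda>e. (\<lambda>v. nverts G + v) ` e) ` edges H\<rparr>"

definition graph_join :: "graph \<Rightarrow> graph \<Rightarrow> graph" where
  "graph_join G H =
     \<lparr>nverts = nverts G + nverts H,
      edges = edges (disjoint_union G H) \<union>
        {{u, nverts G + v} | u v. u < nverts G \<and> v < nverts H}\<rparr>"

primrec copies :: "nat \<Rightarrow> graph \<Rightarrow> graph" where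
  "copies 0 H = \<lparr>nverts = 0, edges = {}\<rparr>"
| "copies (Suc m) H = disjoint_union H (copies m H)"

(* Meaningful for n - 1 >= n1 > n2 >= 1. *)
definition H_OP :: "nat \<Rightarrow> nat \<Rightarrow> nat \<Rightarrow> graph" where
  "H_OP n n1 n2 =
     (if n2 dvd (n - 1 - n1)
      then disjoint_union (path_graph n1) (copies ((n - 1 - n1) div n2) (path_graph n2))
      else disjoint_union
             (disjoint_union (path_graph n1) (copies ((n - 1 - n1) div n2) (path_graph n2)))
             (path_graph (n - 1 - n1 - ((n - 1 - n1) div n2) * n2)))"

(* A topological drawing: vertices are distinct points, edges are simple arcs joining
   their ends, avoiding all other vertices and meeting each other only in common ends. *)
definition plane_embedding :: "graph \<Rightarrow> (nat \<Rightarrow> complex) \<Rightarrow> (nat set \<Rightarrow> real \<Rightarrow> complex) \<Rightarrow> bool" where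
  "plane_embedding G p \<gamma> \<longleftrightarrow>
     inj_on p {..<nverts G} \<and>
     (\<forall>e\<in>edges G. arc (\<gamma> e) \<and> {pathstart (\<gamma> e), pathfinish (\<gamma> e)} = p ` e \<and>
        path_image (\<gamma> e) \<inter> p ` {..<nverts G} = p ` e) \<and>
     (\<forall>e\<in>edges G. \<forall>e'\<in>edges G. e \<noteq> e' \<longrightarrow>
        path_image (\<gamma> e) \<inter> path_image (\<gamma> e') = p ` (e \<inter> e'))"

definition drawing :: "graph \<Rightarrow> (nat \<Rightarrow> complex) \<Rightarrow> (nat set \<Rightarrow> real \<Rightarrow> complex) \<Rightarrow> complex set" where
  "drawing G p \<gamma> = p ` {..<nverts G} \<union> (\<Union>e\<in>edges G. path_image (\<gamma> e))"

(* The drawing is compact, so outside (the union of the unbounded components of the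
   complement) is exactly the outer face. *)
definition outerplanar :: "graph \<Rightarrow> bool" where
  "outerplanar G \<longleftrightarrow>
     (\<exists>p \<gamma>. plane_embedding G p \<gamma> \<and>
        p ` {..<nverts G} \<subseteq> frontier (outside (drawing G p \<gamma>)))"

definition adjacency_matrix :: "graph \<Rightarrow> complex mat" where
  "adjacency_matrix G =
     mat (nverts G) (nverts G) (\<lambda>(i, j). if {i, j} \<in> edges G then 1 else 0)"

definition graph_spectral_radius :: "graph \<Rightarrow> real" where
  "graph_spectral_radius G = spectral_radius (adjacency_matrix G)"

definition outerplanar_free_graphs :: "nat \<Rightarrow> graph \<Rightarrow> graph set" where
  "outerplanar_free_graphs n F =
     {G. simple_graph G \<and> nverts G = n \<and> outerplanar G \<and> graph_free F G}"

(* Labelled graphs on {..<n} form a finite set, so Max is a genuine maximum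
   whenever some graph qualifies and n > 0. *)
definition spex_OP :: "nat \<Rightarrow> graph \<Rightarrow> real" where
  "spex_OP n F = Max (graph_spectral_radius ` outerplanar_free_graphs n F)"

definition extremal_OP :: "nat \<Rightarrow> graph \<Rightarrow> graph \<Rightarrow> bool" where
  "extremal_OP n F G \<longleftrightarrow>
     G \<in> outerplanar_free_graphs n F \<and> graph_spectral_radius G = spex_OP n F"

definition unique_extremal_OP :: "nat \<Rightarrow> graph \<Rightarrow> graph \<Rightarrow> bool" where
  "unique_extremal_OP n F M \<longleftrightarrow>
     extremal_OP n F M \<and> (\<forall>G. extremal_OP n F G \<longrightarrow> graph_iso G M)"

end

(*
  An outerplanar graph contains no subdivided theta graph with a vertex inside each of its three
  paths and no K4: among three arcs with common ends, one runs inside the closed curve formed by the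
  other two, and a vertex lying there is cut off from the outer face. So two vertices have at most
  two common neighbours, and deleting a dominating vertex leaves a linear forest.

  Let G be outerplanar with matching number at most t and spectral radius at least sqrt (n - 1).
  All edges meet the at most 2t ends of a maximum matching. Counting walks of length two from the
  vertex z with the largest entry of a nonnegative vector x with A x >= rho x first shows that z has
  few non-neighbours, then that every other entry is of order 1 / rho, and then that z dominates G.
  The linear forest G - z has matching number at most t - 1, hence at most 2t - 2 edges, and its sum
  of squared degrees is 4 times the number of edges minus the number of leaves. Expanding the
  spectral radius in walk counts of G - z, the number of edges dominates the sum of squared degrees,
  which dominates everything else. So the maximum requires 2t - 2 edges and only two leaves, that is,
  a single path on 2t - 1 vertices.
*)

theory Submission
  imports Defs "HOL-Analysis.Jordan_Curve" "HOL-Complex_Analysis.Winding_Numbers"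
begin

section \<open>Theta curves in the plane\<close>

text \<open>The Jordan curve theorem serves only to exclude theta graphs and K4; the rest of the
  upper bound is counting.

  Radii are compared by inequalities: moduli of an eigenvector give a nonnegative x with A x >=
  \<rho> x, and any nonnegative nonzero y with A y >= \<mu> y certifies \<mu> <= \<rho>. Neither
  needs connectedness or a positive eigenvector, so disconnected graphs need no separate treatment.

  Let e be the number of edges and W the sum of squared degrees after deletion of the dominating
  vertex. The certificate and the upper bound both compare \<rho>^4 with (n-1) \<rho>^2 + 2 e \<rho>
  + W, except that the upper bound has an excess 2 W / (\<rho> - 2). As W <= 8 (t-1) and \<rho> > 16
  t + 2, this excess is below 1, so it cannot outweigh a unit step in e or in the number of leaves.

  The bound on n gives \<rho>^2 >= n - 1 >= N for every competitor, hence \<rho> >= 3400 and \<rho>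
  >= 2^t. The first covers small t, the second large t, and together they give \<rho> > 5 t^2 + 10 t
  + 4, from which the thresholds on \<rho> follow.\<close>

lemma connected_in_disjoint_opens:
  assumes "connected S" "open A" "open B" "A \<inter> B = {}" "S \<subseteq> A \<union> B"
  shows "S \<subseteq> A \<or> S \<subseteq> B"
  using connectedD[of S A B] assms by blast

lemma two_arcs_loop:
  fixes c1 c2 :: "real \<Rightarrow> complex"
  assumes "arc c1" "pathstart c1 = a" "pathfinish c1 = b"
    and "arc c2" "pathstart c2 = a" "pathfinish c2 = b"
    and "path_image c1 \<inter> path_image c2 = {a, b}"
  shows "simple_path (c1 +++ reversepath c2)"
    and "pathfinish (c1 +++ reversepath c2) = pathstart (c1 +++ reversepath c2)"
    and "path_image (c1 +++ reversepath c2) = path_image c1 \<union> path_image c2"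
  using assms by (auto simp: simple_path_join_loop_eq arc_reversepath path_image_join)

lemma two_arcs_inside_outside:
  fixes c1 c2 :: "real \<Rightarrow> complex"
  assumes "arc c1" "pathstart c1 = a" "pathfinish c1 = b"
    and "arc c2" "pathstart c2 = a" "pathfinish c2 = b"
    and "path_image c1 \<inter> path_image c2 = {a, b}"
  defines "J \<equiv> path_image c1 \<union> path_image c2"
  shows "open (inside J)" "connected (inside J)" "inside J \<noteq> {}" "open (outside J)"
    and "inside J \<inter> outside J = {}" "inside J \<union> outside J = - J"
    and "closure (inside J) = inside J \<union> J"
  using Jordan_inside_outside[OF two_arcs_loop(1,2)[OF assms(1-7)]] closure_Un_frontier[of "inside J"]
  unfolding two_arcs_loop(3)[OF assms(1-7)] J_def by auto

lemma open_arc_inside_or_outside: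
  fixes c1 c2 c3 :: "real \<Rightarrow> complex"
  assumes c1: "arc c1" "pathstart c1 = a" "pathfinish c1 = b"
    and c2: "arc c2" "pathstart c2 = a" "pathfinish c2 = b"
    and c3: "arc c3" "pathstart c3 = a" "pathfinish c3 = b"
    and i12: "path_image c1 \<inter> path_image c2 = {a, b}"
    and i13: "path_image c1 \<inter> path_image c3 = {a, b}"
    and i23: "path_image c2 \<inter> path_image c3 = {a, b}"
  shows "path_image c3 - {a, b} \<subseteq> inside (path_image c1 \<union> path_image c2) \<or>
    path_image c3 - {a, b} \<subseteq> outside (path_image c1 \<union> path_image c2)"
proof -
  note io = two_arcs_inside_outside[OF c1 c2 i12]
  have "connected (path_image c3 - {a, b})"
    using connected_simple_path_endless[of c3] c3 arc_imp_simple_path by auto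
  moreover have "path_image c3 - {a, b} \<subseteq> - (path_image c1 \<union> path_image c2)"
    using i13 i23 by auto
  ultimately show ?thesis
    using connected_in_disjoint_opens[OF _ io(1,4,5)] io(6) by blast
qed

text \<open>The inside of the first curve is connected and avoids the second curve, so it lies on
  one side of it. If that were the inner side, then passing to closures would force
  \<open>c2\<close> into the closed inner region, although its open part is nonempty and lies
  outside.\<close>

lemma theta_insides_disjoint:
  fixes c1 c2 c3 :: "real \<Rightarrow> complex"
  assumes c1: "arc c1" "pathstart c1 = a" "pathfinish c1 = b"
    and c2: "arc c2" "pathstart c2 = a" "pathfinish c2 = b"
    and c3: "arc c3" "pathstart c3 = a" "pathfinish c3 = b"
    and i12: "path_image c1 \<inter> path_image c2 = {a, b}"
    and i13: "path_image c1 \<inter> path_image c3 = {a, b}"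
    and i23: "path_image c2 \<inter> path_image c3 = {a, b}"
    and o2: "path_image c2 - {a, b} \<subseteq> outside (path_image c1 \<union> path_image c3)"
    and o3: "path_image c3 - {a, b} \<subseteq> outside (path_image c1 \<union> path_image c2)"
  shows "inside (path_image c1 \<union> path_image c2) \<subseteq> outside (path_image c1 \<union> path_image c3)"
proof -
  let ?J12 = "path_image c1 \<union> path_image c2" and ?J13 = "path_image c1 \<union> path_image c3"
  note io12 = two_arcs_inside_outside[OF c1 c2 i12]
  note io13 = two_arcs_inside_outside[OF c1 c3 i13]
  have "inside ?J12 \<subseteq> - ?J13"
    using o3 io12(5,6) i12 by blast
  then have "inside ?J12 \<subseteq> inside ?J13 \<or> inside ?J12 \<subseteq> outside ?J13"
    using connected_in_disjoint_opens[OF io12(2) io13(1,4,5)] io13(6) by blast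
  moreover have "\<not> inside ?J12 \<subseteq> inside ?J13"
  proof
    assume "inside ?J12 \<subseteq> inside ?J13"
    then have "path_image c2 \<subseteq> inside ?J13 \<union> ?J13"
      using closure_mono[of "inside ?J12" "inside ?J13"] io12(7) io13(7) by auto
    then have "path_image c2 - {a, b} = {}"
      using o2 io13(5,6) by blast
    moreover have "path_image c2 - {a, b} \<noteq> {}"
      using simple_path_endless[of c2] c2 arc_imp_simple_path by force
    ultimately show False by simp
  qed
  ultimately show ?thesis by blast
qed

text \<open>If every open arc were outside the closed curve formed by the other two, a point inside one
  of the three curves would be outside the other two. But the winding numbers of the three closed
  curves, coherently oriented, add up to zero.\<close>

lemma theta_some_arc_inside:
  fixes c1 c2 c3 :: "real \<Rightarrow> complex"
  assumes c1: "arc c1" "pathstart c1 = a" "pathfinish c1 = b"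
    and c2: "arc c2" "pathstart c2 = a" "pathfinish c2 = b"
    and c3: "arc c3" "pathstart c3 = a" "pathfinish c3 = b"
    and i12: "path_image c1 \<inter> path_image c2 = {a, b}"
    and i13: "path_image c1 \<inter> path_image c3 = {a, b}"
    and i23: "path_image c2 \<inter> path_image c3 = {a, b}"
  shows "path_image c1 - {a, b} \<subseteq> inside (path_image c2 \<union> path_image c3) \<or>
    path_image c2 - {a, b} \<subseteq> inside (path_image c1 \<union> path_image c3) \<or>
    path_image c3 - {a, b} \<subseteq> inside (path_image c1 \<union> path_image c2)"
proof (rule ccontr)
  assume "\<not> ?thesis"
  moreover note i21 = i12[unfolded Int_commute[of "path_image c1"]]
    and i31 = i13[unfolded Int_commute[of "path_image c1"]]
    and i32 = i23[unfolded Int_commute[of "path_image c2"]]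
  ultimately have o: "path_image c1 - {a, b} \<subseteq> outside (path_image c2 \<union> path_image c3)"
    "path_image c2 - {a, b} \<subseteq> outside (path_image c1 \<union> path_image c3)"
    "path_image c3 - {a, b} \<subseteq> outside (path_image c1 \<union> path_image c2)"
    using open_arc_inside_or_outside[OF c1 c2 c3 i12 i13 i23]
      open_arc_inside_or_outside[OF c1 c3 c2 i13 i12 i32]
      open_arc_inside_or_outside[OF c2 c3 c1 i23 i21 i31] by blast+
  obtain z where z: "z \<in> inside (path_image c1 \<union> path_image c2)"
    using two_arcs_inside_outside(3)[OF c1 c2 i12] by blast
  have z13: "z \<in> outside (path_image c1 \<union> path_image c3)"
    using theta_insides_disjoint[OF c1 c2 c3 i12 i13 i23] o z by blast
  have z23: "z \<in> outside (path_image c2 \<union> path_image c3)"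
    using theta_insides_disjoint[OF c2 c1 c3 i21 i23 i13] o z by (auto simp: Un_commute)
  have nz: "z \<notin> path_image c1" "z \<notin> path_image c2" "z \<notin> path_image c3"
    using z13 z23 outside_no_overlap by blast+
  have w: "winding_number (d +++ reversepath e) z = winding_number d z - winding_number e z"
    if "arc d" "arc e" "pathfinish d = pathfinish e" "z \<notin> path_image d" "z \<notin> path_image e" for d e
    using that by (simp add: winding_number_join winding_number_reversepath arc_imp_path)
  have "winding_number (c1 +++ reversepath c3) z = 0" "winding_number (c2 +++ reversepath c3) z = 0"
    using two_arcs_loop[OF c1 c3 i13] two_arcs_loop[OF c2 c3 i23] z13 z23
    by (auto intro!: winding_number_zero_in_outside simp: simple_path_imp_path)
  moreover have "norm (winding_number (c1 +++ reversepath c2) z) = 1"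
    using two_arcs_loop[OF c1 c2 i12] z by (intro simple_closed_path_norm_winding_number_inside) auto
  ultimately show False
    using w[of c1 c2] w[of c1 c3] w[of c2 c3] nz c1 c2 c3 by simp
qed

text \<open>This is how the frontier condition of \<open>outerplanar\<close> is exploited: a region
  enclosed by part of the drawing is open and disjoint from the outer face, hence disjoint from the
  closure of that face as well.\<close>

lemma not_inside_if_outer:
  fixes x :: complex
  assumes "x \<in> frontier (outside D)" and "J \<subseteq> D" "closed J"
  shows "x \<notin> inside J"
proof
  assume x: "x \<in> inside J"
  have "inside J \<inter> outside D = {}"
    using outside_mono[OF assms(2)] inside_Int_outside[of J] by blast
  moreover have "open (inside J)"
    using assms(3) by (rule open_inside)
  ultimately have "inside J \<inter> closure (outside D) = {}"
    using open_Int_closure_eq_empty by blast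
  with x assms(1) show False
    by (auto simp: frontier_def)
qed

lemma no_theta_on_outer_boundary:
  fixes c1 c2 c3 :: "real \<Rightarrow> complex"
  assumes c1: "arc c1" "pathstart c1 = a" "pathfinish c1 = b"
    and c2: "arc c2" "pathstart c2 = a" "pathfinish c2 = b"
    and c3: "arc c3" "pathstart c3 = a" "pathfinish c3 = b"
    and i12: "path_image c1 \<inter> path_image c2 = {a, b}"
    and i13: "path_image c1 \<inter> path_image c3 = {a, b}"
    and i23: "path_image c2 \<inter> path_image c3 = {a, b}"
    and D: "path_image c1 \<subseteq> D" "path_image c2 \<subseteq> D" "path_image c3 \<subseteq> D"
    and "x1 \<in> path_image c1 - {a, b}" "x2 \<in> path_image c2 - {a, b}" "x3 \<in> path_image c3 - {a, b}"
    and "{x1, x2, x3} \<subseteq> frontier (outside D)"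
  shows False
proof -
  have cl: "closed (path_image c1)" "closed (path_image c2)" "closed (path_image c3)"
    using c1 c2 c3 by (auto simp: closed_arc_image)
  have "x1 \<notin> inside (path_image c2 \<union> path_image c3)"
    by (rule not_inside_if_outer[of _ D]) (use assms cl in auto)
  moreover have "x2 \<notin> inside (path_image c1 \<union> path_image c3)"
    by (rule not_inside_if_outer[of _ D]) (use assms cl in auto)
  moreover have "x3 \<notin> inside (path_image c1 \<union> path_image c2)"
    by (rule not_inside_if_outer[of _ D]) (use assms cl in auto)
  ultimately show False
    using theta_some_arc_inside[OF c1 c2 c3 i12 i13 i23] assms by blast
qed

section \<open>Subgraphs excluded by outerplanarity\<close>

definition nbrs :: "graph \<Rightarrow> nat \<Rightarrow> nat set" where
  "nbrs G v = {u. {v, u} \<in> edges G}"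

lemma nbrs_subset: "simple_graph G \<Longrightarrow> nbrs G v \<subseteq> {..<nverts G} - {v}"
  unfolding simple_graph_def nbrs_def by (fastforce simp: subset_eq)

lemma finite_nbrs: "simple_graph G \<Longrightarrow> finite (nbrs G v)"
  using nbrs_subset finite_subset by blast

lemma nbrs_sym: "u \<in> nbrs G v \<longleftrightarrow> v \<in> nbrs G u"
  by (simp add: nbrs_def insert_commute)

section \<open>Paths in a drawn graph\<close>

fun walk_edges :: "'a list \<Rightarrow> 'a set set" where
  "walk_edges (a # b # vs) = insert {a, b} (walk_edges (b # vs))"
| "walk_edges _ = {}"

lemma walk_edges_subset: "e \<in> walk_edges vs \<Longrightarrow> e \<subseteq> set vs"
  by (induction vs rule: walk_edges.induct) auto

lemma Union_walk_edges: "length vs \<ge> 2 \<Longrightarrow> \<Union>(walk_edges vs) = set vs"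
proof (induction vs rule: walk_edges.induct)
  case (1 a b vs)
  then show ?case by (cases vs) auto
qed auto

lemma walk_edges_snoc: "vs \<noteq> [] \<Longrightarrow> walk_edges (vs @ [a]) = insert {last vs, a} (walk_edges vs)"
  by (induction vs rule: walk_edges.induct) auto

lemma plane_embedding_edge:
  assumes "plane_embedding G p \<gamma>" and "e \<in> edges G"
  shows "arc (\<gamma> e)" "{pathstart (\<gamma> e), pathfinish (\<gamma> e)} = p ` e" "p ` e \<subseteq> path_image (\<gamma> e)"
  using assms unfolding plane_embedding_def by blast+

lemma plane_embedding_Int:
  assumes "plane_embedding G p \<gamma>" and "e \<in> edges G" "e' \<in> edges G" "e \<noteq> e'"
  shows "path_image (\<gamma> e) \<inter> path_image (\<gamma> e') = p ` (e \<inter> e')"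
  using assms unfolding plane_embedding_def by auto

text \<open>An embedding fixes only the unordered pair of ends of each arc; reversing the arc where
  necessary provides the direction that concatenation requires.\<close>

lemma plane_embedding_edge_arc:
  assumes "plane_embedding G p \<gamma>" and "{u, v} \<in> edges G"
  obtains c where "arc c" "pathstart c = p u" "pathfinish c = p v"
    "path_image c = path_image (\<gamma> {u, v})"
proof -
  note * = plane_embedding_edge[OF assms]
  then have "pathstart (\<gamma> {u, v}) = p u \<and> pathfinish (\<gamma> {u, v}) = p v \<or>
      pathstart (\<gamma> {u, v}) = p v \<and> pathfinish (\<gamma> {u, v}) = p u"
    by (auto simp: doubleton_eq_iff)
  then show ?thesis
    using that[of "\<gamma> {u, v}"] that[of "reversepath (\<gamma> {u, v})"] *(1) by (auto simp: arc_reversepath)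
qed

lemma plane_embedding_walk_arc:
  assumes "plane_embedding G p \<gamma>" and "distinct vs" "length vs \<ge> 2" "walk_edges vs \<subseteq> edges G"
  shows "\<exists>c. arc c \<and> pathstart c = p (hd vs) \<and> pathfinish c = p (last vs) \<and>
    path_image c = (\<Union>e\<in>walk_edges vs. path_image (\<gamma> e))"
  using assms(2-)
proof (induction vs rule: walk_edges.induct)
  case (1 a b vs)
  obtain c where c: "arc c" "pathstart c = p a" "pathfinish c = p b"
    "path_image c = path_image (\<gamma> {a, b})"
    using plane_embedding_edge_arc[OF assms(1), of a b] 1 by auto
  show ?case
  proof (cases vs)
    case Nil
    with c show ?thesis by (intro exI[of _ c]) auto
  next
    case (Cons d ws)
    with 1 obtain c' where c': "arc c'" "pathstart c' = p b" "pathfinish c' = p (last (b # vs))"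
      "path_image c' = (\<Union>e\<in>walk_edges (b # vs). path_image (\<gamma> e))"
      by auto
    \<comment> \<open>The new first vertex \<open>a\<close> is on no later edge, so the new arc
      meets the old one at most in \<open>p b\<close>, and the concatenation is again an
      arc.\<close>
    have "path_image (\<gamma> {a, b}) \<inter> path_image (\<gamma> e) \<subseteq> {p b}" if "e \<in> walk_edges (b # vs)" for e
    proof -
      have "a \<notin> e" using walk_edges_subset[OF that] 1(2) by auto
      then show ?thesis
        using plane_embedding_Int[OF assms(1), of "{a, b}" e] that 1(4) by auto
    qed
    then have "path_image c \<inter> path_image c' \<subseteq> {pathstart c'}"
      unfolding c(4) c'(2,4) by blast
    then have "arc (c +++ c')"
      using c c' by (intro arc_join) auto
    then show ?thesis
      using c c' by (intro exI[of _ "c +++ c'"]) (auto simp: path_image_join)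
  qed
qed auto

text \<open>Distinct edges meet exactly in the images of their common ends. Without a common edge
  this applies to every pair, and the union over all pairs gives the common vertices.\<close>

lemma plane_embedding_walks_Int:
  assumes "plane_embedding G p \<gamma>"
    and "walk_edges vs \<subseteq> edges G" "walk_edges ws \<subseteq> edges G"
    and "walk_edges vs \<inter> walk_edges ws = {}" "length vs \<ge> 2" "length ws \<ge> 2"
  shows "(\<Union>e\<in>walk_edges vs. path_image (\<gamma> e)) \<inter> (\<Union>e\<in>walk_edges ws. path_image (\<gamma> e)) =
    p ` (set vs \<inter> set ws)"
proof -
  have "(\<Union>e\<in>walk_edges vs. path_image (\<gamma> e)) \<inter> (\<Union>e\<in>walk_edges ws. path_image (\<gamma> e)) =
      (\<Union>e\<in>walk_edges vs. \<Union>e'\<in>walk_edges ws. path_image (\<gamma> e) \<inter> path_image (\<gamma> e'))"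
    by blast
  also have "\<dots> = (\<Union>e\<in>walk_edges vs. \<Union>e'\<in>walk_edges ws. p ` (e \<inter> e'))"
  proof (intro SUP_cong refl)
    fix e e' assume "e \<in> walk_edges vs" "e' \<in> walk_edges ws"
    then show "path_image (\<gamma> e) \<inter> path_image (\<gamma> e') = p ` (e \<inter> e')"
      using assms(2-4) by (intro plane_embedding_Int[OF assms(1)]) auto
  qed
  also have "\<dots> = p ` (\<Union>(walk_edges vs) \<inter> \<Union>(walk_edges ws))"
    by auto
  finally show ?thesis
    using assms by (simp add: Union_walk_edges)
qed

definition walk_between :: "graph \<Rightarrow> nat \<Rightarrow> nat \<Rightarrow> nat list \<Rightarrow> bool" where
  "walk_between G a b vs \<longleftrightarrow> distinct vs \<and> length vs \<ge> 2 \<and> hd vs = a \<and> last vs = b \<and>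
     walk_edges vs \<subseteq> edges G \<and> set vs \<subseteq> {..<nverts G}"

lemma walk_between_arc:
  assumes "plane_embedding G p \<gamma>" and "walk_between G a b vs"
  obtains c where "arc c" "pathstart c = p a" "pathfinish c = p b"
    "path_image c = (\<Union>e\<in>walk_edges vs. path_image (\<gamma> e))" "p ` set vs \<subseteq> path_image c"
    "path_image c \<subseteq> drawing G p \<gamma>"
proof -
  from assms have vs: "distinct vs" "length vs \<ge> 2" "hd vs = a" "last vs = b"
    "walk_edges vs \<subseteq> edges G"
    by (auto simp: walk_between_def)
  obtain c where c: "arc c" "pathstart c = p a" "pathfinish c = p b"
    "path_image c = (\<Union>e\<in>walk_edges vs. path_image (\<gamma> e))"
    using plane_embedding_walk_arc[OF assms(1) vs(1,2,5)] vs by auto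
  have "p ` \<Union>(walk_edges vs) \<subseteq> path_image c"
    using plane_embedding_edge(3)[OF assms(1)] vs(5) unfolding c(4) by blast
  moreover have "path_image c \<subseteq> drawing G p \<gamma>"
    using vs(5) unfolding c(4) drawing_def by auto
  ultimately show ?thesis
    using that[OF c] vs(2) by (simp add: Union_walk_edges)
qed

text \<open>The three drawn paths form a theta curve, and each open arc carries a vertex; the arc
  that runs inside the other two would hide its vertex from the outer face.\<close>

lemma outerplanar_no_theta:
  assumes "outerplanar G"
    and w: "walk_between G a b us" "walk_between G a b vs" "walk_between G a b ws"
    and i: "set us \<inter> set vs = {a, b}" "set us \<inter> set ws = {a, b}" "set vs \<inter> set ws = {a, b}"
    and d: "walk_edges us \<inter> walk_edges vs = {}" "walk_edges us \<inter> walk_edges ws = {}"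
      "walk_edges vs \<inter> walk_edges ws = {}"
    and x: "x \<in> set us - {a, b}" "y \<in> set vs - {a, b}" "z \<in> set ws - {a, b}"
  shows False
proof -
  obtain p \<gamma> where emb: "plane_embedding G p \<gamma>"
    and outer: "p ` {..<nverts G} \<subseteq> frontier (outside (drawing G p \<gamma>))"
    using assms(1) unfolding outerplanar_def by blast
  obtain c1 where c1: "arc c1" "pathstart c1 = p a" "pathfinish c1 = p b"
    "path_image c1 = (\<Union>e\<in>walk_edges us. path_image (\<gamma> e))" "p ` set us \<subseteq> path_image c1"
    "path_image c1 \<subseteq> drawing G p \<gamma>"
    using walk_between_arc[OF emb w(1)] .
  obtain c2 where c2: "arc c2" "pathstart c2 = p a" "pathfinish c2 = p b"
    "path_image c2 = (\<Union>e\<in>walk_edges vs. path_image (\<gamma> e))" "p ` set vs \<subseteq> path_image c2"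
    "path_image c2 \<subseteq> drawing G p \<gamma>"
    using walk_between_arc[OF emb w(2)] .
  obtain c3 where c3: "arc c3" "pathstart c3 = p a" "pathfinish c3 = p b"
    "path_image c3 = (\<Union>e\<in>walk_edges ws. path_image (\<gamma> e))" "p ` set ws \<subseteq> path_image c3"
    "path_image c3 \<subseteq> drawing G p \<gamma>"
    using walk_between_arc[OF emb w(3)] .
  have inj: "inj_on p {..<nverts G}"
    using emb by (simp add: plane_embedding_def)
  have ab: "{a, b} \<subseteq> {..<nverts G}" "{x, y, z} \<subseteq> {..<nverts G}"
  proof -
    have "set us \<subseteq> {..<nverts G}" "set vs \<subseteq> {..<nverts G}" "set ws \<subseteq> {..<nverts G}"
      using w by (simp_all add: walk_between_def)
    then show "{a, b} \<subseteq> {..<nverts G}" "{x, y, z} \<subseteq> {..<nverts G}"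
      using x i by blast+
  qed
  have ne: "p v \<notin> {p a, p b}" if "v < nverts G" "v \<notin> {a, b}" for v
    using inj_onD[OF inj] that ab by auto
  have xyz: "p x \<in> path_image c1 - {p a, p b}" "p y \<in> path_image c2 - {p a, p b}"
    "p z \<in> path_image c3 - {p a, p b}"
    using x c1(5) c2(5) c3(5) ne ab by auto
  have "path_image c1 \<inter> path_image c2 = {p a, p b}" "path_image c1 \<inter> path_image c3 = {p a, p b}"
    "path_image c2 \<inter> path_image c3 = {p a, p b}"
    using plane_embedding_walks_Int[OF emb, of us vs] plane_embedding_walks_Int[OF emb, of us ws]
      plane_embedding_walks_Int[OF emb, of vs ws] i d w
    unfolding c1(4) c2(4) c3(4) walk_between_def by auto
  then show False
    by (rule no_theta_on_outer_boundary[OF c1(1-3) c2(1-3) c3(1-3) _ _ _ c1(6) c2(6) c3(6) xyz])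
      (use outer ab in auto)
qed

lemma simple_graph_edge:
  assumes "simple_graph G" "{u, v} \<in> edges G"
  shows "u < nverts G" "v < nverts G" "u \<noteq> v"
  using assms unfolding simple_graph_def by (force simp: card_2_iff)+

text \<open>Three common neighbours would form a K_{2,3}, the theta graph whose three paths have
  length two.\<close>

lemma outerplanar_common_nbrs:
  assumes "outerplanar G" "simple_graph G" "a \<noteq> b"
  shows "card (nbrs G a \<inter> nbrs G b) \<le> 2"
proof (rule ccontr)
  let ?C = "nbrs G a \<inter> nbrs G b"
  assume "\<not> card ?C \<le> 2"
  then have "3 \<le> card ?C" by linarith
  then obtain T where T: "T \<subseteq> ?C" "card T = 3"
    by (rule obtain_subset_with_card_n) blast
  then obtain x y z where "T = {x, y, z}" and d: "x \<noteq> y" "y \<noteq> z" "x \<noteq> z"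
    by (auto simp: card_3_iff)
  then have e: "{x, a} \<in> edges G" "{x, b} \<in> edges G" "{y, a} \<in> edges G" "{y, b} \<in> edges G"
    "{z, a} \<in> edges G" "{z, b} \<in> edges G"
    using T by (auto simp: nbrs_def insert_commute)
  note s = simple_graph_edge[OF assms(2)]
  show False
    by (rule outerplanar_no_theta[OF assms(1), of a b "[a, x, b]" "[a, y, b]" "[a, z, b]" x y z])
      (use e[THEN s(1)] e[THEN s(2)] e[THEN s(3)] e d assms(3) in
        \<open>auto simp: walk_between_def doubleton_eq_iff insert_commute\<close>)
qed

text \<open>By continuity. It carries the information on which side of a curve an open chord lies
  over to the ends of that chord.\<close>

lemma arc_finish_in_closure:
  fixes d :: "real \<Rightarrow> complex"
  assumes "arc d" "path_image d - {pathstart d, pathfinish d} \<subseteq> A"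
  shows "pathfinish d \<in> closure A"
proof -
  have "d ` closure {0<..<1} \<subseteq> closure A"
  proof (rule image_closure_subset)
    show "continuous_on (closure {0<..<1}) d"
      using assms(1) by (simp add: arc_def path_def)
    show "d ` {0<..<1} \<subseteq> closure A"
      using simple_path_endless[of d] assms closure_subset arc_imp_simple_path by fastforce
  qed auto
  then show ?thesis
    by (auto simp: pathfinish_def)
qed

text \<open>The two chords \<open>ab\<close> and \<open>uw\<close> of the 4-cycle \<open>a u b w\<close> would both be drawn inside it, where
  they have to cross.\<close>

lemma outerplanar_no_K4:
  assumes "outerplanar G" "simple_graph G"
    and e: "{a, b} \<in> edges G" "{a, u} \<in> edges G" "{a, w} \<in> edges G" "{b, u} \<in> edges G"
      "{b, w} \<in> edges G" "{u, w} \<in> edges G"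
  shows False
proof -
  obtain p \<gamma> where emb: "plane_embedding G p \<gamma>"
    and outer: "p ` {..<nverts G} \<subseteq> frontier (outside (drawing G p \<gamma>))"
    using assms(1) unfolding outerplanar_def by blast
  note s = simple_graph_edge[OF assms(2)]
  have d: "a \<noteq> b" "a \<noteq> u" "a \<noteq> w" "b \<noteq> u" "b \<noteq> w" "u \<noteq> w"
    and v: "a < nverts G" "b < nverts G" "u < nverts G" "w < nverts G"
    using e[THEN s(1)] e[THEN s(2)] e[THEN s(3)] by auto
  have inj: "inj_on p {..<nverts G}"
    using emb by (simp add: plane_embedding_def)
  have pd: "p a \<noteq> p b" "p a \<noteq> p u" "p a \<noteq> p w" "p b \<noteq> p u" "p b \<noteq> p w" "p u \<noteq> p w"
    using inj_onD[OF inj] d v by auto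
  have e': "{b, a} \<in> edges G" "{u, a} \<in> edges G" "{w, a} \<in> edges G" "{u, b} \<in> edges G"
      "{w, b} \<in> edges G" "{w, u} \<in> edges G"
    using e by (simp_all add: insert_commute)
  have wb: "walk_between G a b [a, b]" "walk_between G a b [a, u, b]" "walk_between G a b [a, w, b]"
    "walk_between G u w [u, w]" "walk_between G u w [u, a, w]" "walk_between G u w [u, b, w]"
    using e e' d v by (auto simp: walk_between_def)
  note walk = walk_between_arc[OF emb]
  obtain c where c: "arc c" "pathstart c = p a" "pathfinish c = p b"
    "path_image c = (\<Union>e\<in>walk_edges [a, b]. path_image (\<gamma> e))" "p ` set [a, b] \<subseteq> path_image c"
    "path_image c \<subseteq> drawing G p \<gamma>"
    using walk[OF wb(1)] .
  obtain c1 where c1: "arc c1" "pathstart c1 = p a" "pathfinish c1 = p b"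
    "path_image c1 = (\<Union>e\<in>walk_edges [a, u, b]. path_image (\<gamma> e))"
    "p ` set [a, u, b] \<subseteq> path_image c1" "path_image c1 \<subseteq> drawing G p \<gamma>"
    using walk[OF wb(2)] .
  obtain c2 where c2: "arc c2" "pathstart c2 = p a" "pathfinish c2 = p b"
    "path_image c2 = (\<Union>e\<in>walk_edges [a, w, b]. path_image (\<gamma> e))"
    "p ` set [a, w, b] \<subseteq> path_image c2" "path_image c2 \<subseteq> drawing G p \<gamma>"
    using walk[OF wb(3)] .
  obtain k where k: "arc k" "pathstart k = p u" "pathfinish k = p w"
    "path_image k = (\<Union>e\<in>walk_edges [u, w]. path_image (\<gamma> e))" "p ` set [u, w] \<subseteq> path_image k"
    "path_image k \<subseteq> drawing G p \<gamma>"
    using walk[OF wb(4)] .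
  obtain k1 where k1: "arc k1" "pathstart k1 = p u" "pathfinish k1 = p w"
    "path_image k1 = (\<Union>e\<in>walk_edges [u, a, w]. path_image (\<gamma> e))"
    "p ` set [u, a, w] \<subseteq> path_image k1" "path_image k1 \<subseteq> drawing G p \<gamma>"
    using walk[OF wb(5)] .
  obtain k2 where k2: "arc k2" "pathstart k2 = p u" "pathfinish k2 = p w"
    "path_image k2 = (\<Union>e\<in>walk_edges [u, b, w]. path_image (\<gamma> e))"
    "p ` set [u, b, w] \<subseteq> path_image k2" "path_image k2 \<subseteq> drawing G p \<gamma>"
    using walk[OF wb(6)] .
  have int: "(\<Union>e\<in>walk_edges vs. path_image (\<gamma> e)) \<inter> (\<Union>e\<in>walk_edges ws. path_image (\<gamma> e)) =
    p ` (set vs \<inter> set ws)" if "walk_between G x y vs" "walk_between G x' y' ws"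
    "walk_edges vs \<inter> walk_edges ws = {}" for x y x' y' vs ws
    using plane_embedding_walks_Int[OF emb] that by (auto simp: walk_between_def)
  have ed: "walk_edges [a, u, b] \<inter> walk_edges [a, w, b] = {}"
    "walk_edges [a, u, b] \<inter> walk_edges [a, b] = {}" "walk_edges [a, w, b] \<inter> walk_edges [a, b] = {}"
    "walk_edges [u, a, w] \<inter> walk_edges [u, b, w] = {}"
    "walk_edges [u, a, w] \<inter> walk_edges [u, w] = {}" "walk_edges [u, b, w] \<inter> walk_edges [u, w] = {}"
    "walk_edges [a, b] \<inter> walk_edges [u, w] = {}"
    using d by (simp_all add: doubleton_eq_iff)
  have sd: "set [a, u, b] \<inter> set [a, w, b] = {a, b}" "set [a, u, b] \<inter> set [a, b] = {a, b}"
    "set [a, w, b] \<inter> set [a, b] = {a, b}" "set [u, a, w] \<inter> set [u, b, w] = {u, w}"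
    "set [u, a, w] \<inter> set [u, w] = {u, w}" "set [u, b, w] \<inter> set [u, w] = {u, w}"
    "set [a, b] \<inter> set [u, w] = {}"
    using d by auto
  have i: "path_image c1 \<inter> path_image c2 = {p a, p b}" "path_image c1 \<inter> path_image c = {p a, p b}"
    "path_image c2 \<inter> path_image c = {p a, p b}"
    "path_image k1 \<inter> path_image k2 = {p u, p w}" "path_image k1 \<inter> path_image k = {p u, p w}"
    "path_image k2 \<inter> path_image k = {p u, p w}" "path_image c \<inter> path_image k = {}"
    unfolding c(4) c1(4) c2(4) k(4) k1(4) k2(4)
      int[OF wb(2,3) ed(1)] int[OF wb(2,1) ed(2)] int[OF wb(3,1) ed(3)]
      int[OF wb(5,6) ed(4)] int[OF wb(5,4) ed(5)] int[OF wb(6,4) ed(6)] int[OF wb(1,4) ed(7)] sd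
    by simp_all
  have cl: "closed (path_image g)" if "arc g" for g :: "real \<Rightarrow> complex"
    using that by (rule closed_arc_image)
  have out: "p x \<notin> inside (path_image f \<union> path_image g)"
    if "x < nverts G" "arc f" "arc g" "path_image f \<subseteq> drawing G p \<gamma>" "path_image g \<subseteq> drawing G p \<gamma>"
    for x f g
    by (rule not_inside_if_outer[of _ "drawing G p \<gamma>"]) (use that outer cl in auto)
  \<comment> \<open>The other two alternatives for the theta curve would enclose \<open>p u\<close>
    or \<open>p w\<close>, and the same reasoning with the roles exchanged places \<open>k\<close>
    inside the same 4-cycle.\<close>
  have cin: "path_image c - {p a, p b} \<subseteq> inside (path_image c1 \<union> path_image c2)"
    using theta_some_arc_inside[OF c1(1-3) c2(1-3) c(1-3) i(1-3)] c1(5) c2(5) pd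
      out[OF v(3) c2(1) c(1) c2(6) c(6)] out[OF v(4) c1(1) c(1) c1(6) c(6)]
    by auto
  have "path_image k - {p u, p w} \<subseteq> inside (path_image k1 \<union> path_image k2)"
    using theta_some_arc_inside[OF k1(1-3) k2(1-3) k(1-3) i(4-6)] k1(5) k2(5) pd
      out[OF v(1) k2(1) k(1) k2(6) k(6)] out[OF v(2) k1(1) k(1) k1(6) k(6)]
    by auto
  moreover have "path_image k1 \<union> path_image k2 = path_image c1 \<union> path_image c2"
    unfolding c1(4) c2(4) k1(4) k2(4) by (auto simp: insert_commute)
  ultimately have kin: "path_image k - {p u, p w} \<subseteq> inside (path_image c1 \<union> path_image c2)"
    by simp
  have "path_image c - {p a, p b} \<noteq> {}"
    using simple_path_endless[OF arc_imp_simple_path[OF c(1)]] c(2,3) by force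
  then have "path_image c \<inter> inside (path_image c1 \<union> path_image c2) \<noteq> {}"
    using cin by auto
  then have sp: "inside (path_image c1 \<union> path_image c) \<inter> inside (path_image c2 \<union> path_image c) = {}"
    "inside (path_image c1 \<union> path_image c) \<union> inside (path_image c2 \<union> path_image c) \<union>
      (path_image c - {p a, p b}) = inside (path_image c1 \<union> path_image c2)"
    using split_inside_simple_closed_curve[OF arc_imp_simple_path[OF c1(1)] c1(2,3)
      arc_imp_simple_path[OF c2(1)] c2(2,3) arc_imp_simple_path[OF c(1)] c(2,3) pd(1) i(1-3)]
    by blast+
  have k': "path_image k - {p u, p w} \<subseteq> inside (path_image c1 \<union> path_image c) \<or>
      path_image k - {p u, p w} \<subseteq> inside (path_image c2 \<union> path_image c)"
  proof (rule connected_in_disjoint_opens)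
    show "connected (path_image k - {p u, p w})"
      using connected_simple_path_endless[of k] k arc_imp_simple_path by auto
    show "path_image k - {p u, p w} \<subseteq> inside (path_image c1 \<union> path_image c) \<union>
        inside (path_image c2 \<union> path_image c)"
      using sp(2) kin i(7) by blast
  qed (use two_arcs_inside_outside(1)[OF c1(1-3) c(1-3) i(2)]
      two_arcs_inside_outside(1)[OF c2(1-3) c(1-3) i(3)] sp(1) in auto)
  have "p u \<in> path_image c1" "p w \<in> path_image c2"
    using c1(5) c2(5) by auto
  moreover have "p u \<notin> {p a, p b}" "p w \<notin> {p a, p b}"
    using pd by auto
  ultimately have "p w \<notin> path_image c1" "p u \<notin> path_image c2"
    using i(1) by blast+
  moreover have "p w \<notin> path_image c" "p u \<notin> path_image c"
    using i(7) k(5) by auto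
  \<comment> \<open>The chord \<open>c\<close> cuts the inside of the 4-cycle into two halves, and
    \<open>k\<close> runs within one of them. The closure of the half at \<open>c1\<close> misses
    \<open>p w\<close> and that of the half at \<open>c2\<close> misses \<open>p u\<close>, while
    \<open>k\<close> ends in both points.\<close>
  ultimately have "p w \<notin> closure (inside (path_image c1 \<union> path_image c))"
    "p u \<notin> closure (inside (path_image c2 \<union> path_image c))"
    using two_arcs_inside_outside(7)[OF c1(1-3) c(1-3) i(2)]
      two_arcs_inside_outside(7)[OF c2(1-3) c(1-3) i(3)]
      out[OF v(4) c1(1) c(1) c1(6) c(6)] out[OF v(3) c2(1) c(1) c2(6) c(6)] by auto
  then show False
    using k' arc_finish_in_closure[of k] arc_finish_in_closure[of "reversepath k"] k(1-3)
    by (auto simp: arc_reversepath insert_commute)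
qed

text \<open>For consecutive rim vertices a, b, c, the paths c b a and c z a and the rest of the rim
  form a theta graph. The last path has an inner vertex only if the rim has at least four vertices;
  for a triangle the wheel is K4, which contains no such theta graph and is excluded
  separately.\<close>

lemma outerplanar_no_wheel:
  assumes "outerplanar G" "simple_graph G"
    and vs: "distinct vs" "length vs \<ge> 3" "walk_edges vs \<subseteq> edges G" "{last vs, hd vs} \<in> edges G"
    and z: "z \<notin> set vs" "\<And>v. v \<in> set vs \<Longrightarrow> {z, v} \<in> edges G"
  shows False
proof -
  obtain a b c ws where ws: "vs = a # b # c # ws"
    using vs(2) by (auto simp: numeral_3_eq_3 Suc_le_length_iff)
  have e: "{a, b} \<in> edges G" "{b, c} \<in> edges G" "walk_edges (c # ws) \<subseteq> edges G"
    "{z, a} \<in> edges G" "{z, b} \<in> edges G" "{z, c} \<in> edges G"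
    using vs(3) z(2) unfolding ws by auto
  have V: "set vs \<subseteq> {..<nverts G}" "z < nverts G"
    using simple_graph_edge(1,2)[OF assms(2) z(2)] ws by auto
  show False
  proof (cases ws)
    case Nil
    then have "{c, a} \<in> edges G"
      using vs(4) ws by simp
    then show False
      using outerplanar_no_K4[OF assms(1,2), of a b c z] e by (simp add: insert_commute)
  next
    case (Cons d us)
    have cl: "{last ws, a} \<in> edges G"
      using vs(4) ws Cons by simp
    have we: "walk_edges (c # ws @ [a]) = insert {last ws, a} (walk_edges (c # ws))"
      using walk_edges_snoc[of "c # ws" a] Cons by simp
    have nin: "{c, b} \<notin> walk_edges (c # ws @ [a])" "{b, a} \<notin> walk_edges (c # ws @ [a])"
      "{c, z} \<notin> walk_edges (c # ws @ [a])" "{z, a} \<notin> walk_edges (c # ws @ [a])"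
      using walk_edges_subset[of _ "c # ws @ [a]"] vs(1) z(1) ws by auto
    have V': "a < nverts G" "b < nverts G" "c < nverts G" "z < nverts G" "set ws \<subseteq> {..<nverts G}"
      and d: "a \<noteq> b" "a \<noteq> c" "b \<noteq> c" "z \<noteq> a" "z \<noteq> b" "z \<noteq> c" "d \<noteq> a" "d \<noteq> c"
        "d \<in> set ws" "a \<notin> set ws" "b \<notin> set ws" "c \<notin> set ws" "z \<notin> set ws" "distinct ws"
      using vs(1) V z(1) Cons by (auto simp: ws)
    have w: "walk_between G c a [c, b, a]" "walk_between G c a [c, z, a]"
      "walk_between G c a (c # ws @ [a])"
      unfolding walk_between_def we using e cl V' d by (auto simp: insert_commute)
    show False
    proof (rule outerplanar_no_theta[OF assms(1) w, of b z d])
      show "walk_edges [c, b, a] \<inter> walk_edges [c, z, a] = {}"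
        using d by (simp add: doubleton_eq_iff)
      show "walk_edges [c, b, a] \<inter> walk_edges (c # ws @ [a]) = {}"
        "walk_edges [c, z, a] \<inter> walk_edges (c # ws @ [a]) = {}"
        using nin by simp_all
    qed (use d in auto)
  qed
qed

section \<open>Outerplanarity of fans\<close>

text \<open>A common normal form for both cases of the theorem: hub 0, a path on the vertices 1,
  ..., k, and all other vertices pendant at the hub. The star is the case k = 1, and k = 2 t - 1 is
  the extremal graph for every t.\<close>

definition fan_graph :: "nat \<Rightarrow> nat \<Rightarrow> graph" where
  "fan_graph n k = \<lparr>nverts = n, edges = {{0, j} | j. 1 \<le> j \<and> j < n} \<union> {{j, Suc j} | j. 1 \<le> j \<and> j < k}\<rparr>"

lemma nverts_fan_graph [simp]: "nverts (fan_graph n k) = n"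
  by (simp add: fan_graph_def)

lemma fan_graph_edge_cases:
  assumes "e \<in> edges (fan_graph n k)"
  obtains (spoke) j where "e = {0, j}" "1 \<le> j" "j < n"
  | (rim) j where "e = {j, Suc j}" "1 \<le> j" "j < k"
  using assms by (auto simp: fan_graph_def)

lemma simple_fan_graph: "k < n \<Longrightarrow> simple_graph (fan_graph n k)"
  unfolding simple_graph_def by (auto elim!: fan_graph_edge_cases)

text \<open>The hub is at the origin and vertex j at height j on the line Re = 1, so a spoke is a
  segment of slope j and rim edges are consecutive vertical segments. All vertices then lie on the
  left or the right side of a box that contains the drawing.\<close>

definition fan_point :: "nat \<Rightarrow> complex" where
  "fan_point j = (if j = 0 then 0 else Complex 1 (real j))"

definition fan_path :: "nat set \<Rightarrow> real \<Rightarrow> complex" where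
  "fan_path e = linepath (fan_point (Min e)) (fan_point (Max e))"

lemma fan_path_spoke:
  assumes "1 \<le> j"
  shows "fan_path {0, j} = linepath 0 (Complex 1 (real j))"
  using assms by (simp add: fan_path_def fan_point_def)

lemma fan_path_rim:
  assumes "1 \<le> j"
  shows "fan_path {j, Suc j} = linepath (Complex 1 (real j)) (Complex 1 (real j + 1))"
proof -
  have "Min {j, Suc j} = j" "Max {j, Suc j} = Suc j" by auto
  with assms show ?thesis by (simp add: fan_path_def fan_point_def add.commute)
qed

lemma mem_fan_spoke:
  assumes "1 \<le> j"
  shows "z \<in> path_image (fan_path {0, j}) \<longleftrightarrow> 0 \<le> Re z \<and> Re z \<le> 1 \<and> Im z = real j * Re z"
  unfolding fan_path_spoke[OF assms] path_image_linepath in_segment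
  by (auto simp: complex_eq_iff)

lemma mem_fan_rim:
  assumes "1 \<le> j"
  shows "z \<in> path_image (fan_path {j, Suc j}) \<longleftrightarrow> Re z = 1 \<and> real j \<le> Im z \<and> Im z \<le> real j + 1"
proof -
  have "z \<in> path_image (fan_path {j, Suc j}) \<longleftrightarrow> (\<exists>u. 0 \<le> u \<and> u \<le> 1 \<and> Re z = 1 \<and> Im z = real j + u)"
    unfolding fan_path_rim[OF assms] path_image_linepath in_segment
    by (auto simp: complex_eq_iff algebra_simps)
  also have "\<dots> \<longleftrightarrow> Re z = 1 \<and> real j \<le> Im z \<and> Im z \<le> real j + 1"
    by (auto intro!: exI[of _ "Im z - real j"])
  finally show ?thesis .
qed

lemma fan_point_simps: "Re (fan_point i) = (if i = 0 then 0 else 1)" "Im (fan_point i) = real i"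
  by (simp_all add: fan_point_def)

lemma inj_fan_point: "inj fan_point"
  by (auto simp: inj_def dest: arg_cong[of _ _ Im] simp: fan_point_simps)

lemma fan_path_spoke_spoke:
  assumes "1 \<le> j" "1 \<le> i" "i \<noteq> j"
  shows "path_image (fan_path {0, j}) \<inter> path_image (fan_path {0, i}) = {fan_point 0}"
  using assms by (auto simp: mem_fan_spoke fan_point_simps complex_eq_iff)

lemma fan_path_spoke_rim:
  assumes "1 \<le> j" "1 \<le> i"
  shows "path_image (fan_path {0, j}) \<inter> path_image (fan_path {i, Suc i}) = fan_point ` ({0, j} \<inter> {i, Suc i})"
proof (intro equalityI subsetI)
  fix z assume "z \<in> path_image (fan_path {0, j}) \<inter> path_image (fan_path {i, Suc i})"
  then have z: "Re z = 1" "Im z = real j" "real i \<le> real j" "real j \<le> real i + 1"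
    using assms by (auto simp: mem_fan_spoke mem_fan_rim)
  then have "z = fan_point j" "j \<in> {i, Suc i}"
    using assms by (auto simp: complex_eq_iff fan_point_simps)
  then show "z \<in> fan_point ` ({0, j} \<inter> {i, Suc i})" by blast
next
  fix z assume "z \<in> fan_point ` ({0, j} \<inter> {i, Suc i})"
  then show "z \<in> path_image (fan_path {0, j}) \<inter> path_image (fan_path {i, Suc i})"
    using assms by (auto simp: mem_fan_spoke mem_fan_rim fan_point_simps)
qed

lemma fan_path_rim_rim:
  assumes "1 \<le> j" "j < i"
  shows "path_image (fan_path {j, Suc j}) \<inter> path_image (fan_path {i, Suc i}) = fan_point ` ({j, Suc j} \<inter> {i, Suc i})"
proof (intro equalityI subsetI)
  fix z assume "z \<in> path_image (fan_path {j, Suc j}) \<inter> path_image (fan_path {i, Suc i})"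
  then have z: "Re z = 1" "real i \<le> Im z" "Im z \<le> real j + 1"
    using assms by (auto simp: mem_fan_rim)
  then have "i = Suc j" using assms by linarith
  moreover from this have "z = fan_point i"
    using z by (auto simp: complex_eq_iff fan_point_simps)
  ultimately show "z \<in> fan_point ` ({j, Suc j} \<inter> {i, Suc i})" by blast
next
  fix z assume "z \<in> fan_point ` ({j, Suc j} \<inter> {i, Suc i})"
  then show "z \<in> path_image (fan_path {j, Suc j}) \<inter> path_image (fan_path {i, Suc i})"
    using assms by (auto simp: mem_fan_rim fan_point_simps)
qed

lemma plane_embedding_fan_graph:
  assumes "k < n"
  shows "plane_embedding (fan_graph n k) fan_point fan_path"
  unfolding plane_embedding_def
proof (intro conjI ballI impI)
  show "inj_on fan_point {..<nverts (fan_graph n k)}"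
    using inj_fan_point by (rule inj_on_subset) simp
next
  fix e assume "e \<in> edges (fan_graph n k)"
  then show "arc (fan_path e)"
    by (cases rule: fan_graph_edge_cases)
      (auto simp: fan_path_spoke fan_path_rim complex_eq_iff simp del: arc_linepath intro!: arc_linepath)
next
  fix e assume "e \<in> edges (fan_graph n k)"
  then show "{pathstart (fan_path e), pathfinish (fan_path e)} = fan_point ` e"
    by (cases rule: fan_graph_edge_cases)
      (auto simp: fan_path_spoke fan_path_rim fan_point_def complex_eq_iff)
next
  fix e assume e: "e \<in> edges (fan_graph n k)"
  then have "e \<subseteq> {..<n}"
    using simple_fan_graph[OF assms] by (auto simp: simple_graph_def)
  moreover have "fan_point i \<in> path_image (fan_path e) \<longleftrightarrow> i \<in> e" for i
    using e by (cases rule: fan_graph_edge_cases)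
      (auto simp: mem_fan_spoke mem_fan_rim fan_point_simps)
  ultimately show "path_image (fan_path e) \<inter> fan_point ` {..<nverts (fan_graph n k)} = fan_point ` e"
    by auto
next
  show "path_image (fan_path e) \<inter> path_image (fan_path e') = fan_point ` (e \<inter> e')"
    if "e \<in> edges (fan_graph n k)" "e' \<in> edges (fan_graph n k)" "e \<noteq> e'" for e e'
    using that(1)
  proof (cases rule: fan_graph_edge_cases)
    case (spoke j)
    note j = this
    from that(2) show ?thesis
    proof (cases rule: fan_graph_edge_cases)
      case (spoke i)
      with j that(3) have "i \<noteq> j" by auto
      moreover from this have "e \<inter> e' = {0}" using j spoke by auto
      ultimately show ?thesis using j spoke fan_path_spoke_spoke[of j i] by simp
    next
      case (rim i)
      with j show ?thesis using fan_path_spoke_rim[of j i] by simp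
    qed
  next
    case (rim j)
    note j = this
    from that(2) show ?thesis
    proof (cases rule: fan_graph_edge_cases)
      case (spoke i)
      with j show ?thesis using fan_path_spoke_rim[of i j] by (simp only: Int_commute)
    next
      case (rim i)
      with j that(3) have "i < j \<or> j < i" by auto
      with j rim show ?thesis using fan_path_rim_rim[of j i] fan_path_rim_rim[of i j]
        by (auto simp only: Int_commute)
    qed
  qed
qed

lemma outerplanar_fan_graph:
  assumes "k < n"
  shows "outerplanar (fan_graph n k)"
  unfolding outerplanar_def
proof (intro exI conjI)
  show "plane_embedding (fan_graph n k) fan_point fan_path"
    using assms by (rule plane_embedding_fan_graph)
  let ?D = "drawing (fan_graph n k) fan_point fan_path"
  \<comment> \<open>The complement of this convex box is outside the box, hence outside the
    drawing.\<close>
  define K where "K = cbox 0 (Complex 1 (real n))"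
  have K: "z \<in> K \<longleftrightarrow> 0 \<le> Re z \<and> Re z \<le> 1 \<and> 0 \<le> Im z \<and> Im z \<le> real n" for z
    by (auto simp: K_def in_cbox_complex_iff)
  have "path_image (fan_path e) \<subseteq> K" if "e \<in> edges (fan_graph n k)" for e
    using that
  proof (cases rule: fan_graph_edge_cases)
    case (spoke j)
    show ?thesis
    proof
      fix z assume "z \<in> path_image (fan_path e)"
      then have z: "0 \<le> Re z" "Re z \<le> 1" "Im z = real j * Re z"
        using spoke by (auto simp: mem_fan_spoke)
      then have "Im z \<le> real j * 1"
        using mult_left_mono[of "Re z" 1 "real j"] by simp
      then have "Im z \<le> real n"
        using spoke(3) by linarith
      moreover have "0 \<le> Im z" using z by simp
      ultimately show "z \<in> K"
        using z by (simp only: K)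
    qed
  next
    case (rim j)
    then show ?thesis using assms by (auto simp: mem_fan_rim K)
  qed
  moreover have "fan_point ` {..<n} \<subseteq> K"
    by (auto simp: K fan_point_simps)
  ultimately have DK: "?D \<subseteq> K"
    by (auto simp: drawing_def)
  have "outside K = - K"
    by (rule outside_convex) (simp add: K_def convex_box)
  then have out: "- K \<subseteq> outside ?D"
    using outside_mono[OF DK] by simp
  show "fan_point ` {..<nverts (fan_graph n k)} \<subseteq> frontier (outside ?D)"
  proof
    fix q assume q: "q \<in> fan_point ` {..<nverts (fan_graph n k)}"
    then have "q \<in> ?D" by (simp add: drawing_def)
    then have "q \<notin> outside ?D" using outside_no_overlap by blast
    moreover have "q \<in> closure (outside ?D)"
      unfolding closure_approachable
    proof (intro allI impI)
      fix \<epsilon> :: real assume "\<epsilon> > 0"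
      \<comment> \<open>The hub is on the left side of the box and all other vertices on the right
        side, so an arbitrarily small horizontal shift leaves the box.\<close>
      define w where "w = q + of_real (if Re q = 0 then - \<epsilon> / 2 else \<epsilon> / 2)"
      have "w \<notin> K" using q \<open>\<epsilon> > 0\<close> by (auto simp: K w_def fan_point_simps split: if_splits)
      moreover have "dist w q < \<epsilon>"
        using \<open>\<epsilon> > 0\<close> by (auto simp: w_def dist_norm)
      ultimately show "\<exists>w\<in>outside ?D. dist w q < \<epsilon>"
        using out by blast
    qed
    ultimately show "q \<in> frontier (outside ?D)"
      using interior_subset by (auto simp: frontier_def)
  qed
qed

section \<open>Spectral radius and sub- and superharmonic vectors\<close>

lemma adjacency_matrix_carrier: "adjacency_matrix G \<in> carrier_mat (nverts G) (nverts G)"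
  by (simp add: adjacency_matrix_def)

lemma sum_adjacent:
  fixes f :: "nat \<Rightarrow> 'a::semiring_0"
  assumes "simple_graph G"
  shows "(\<Sum>j\<in>{0..<nverts G}. (if {i, j} \<in> edges G then c else 0) * f j) = (\<Sum>j\<in>nbrs G i. c * f j)"
proof -
  have "{j \<in> {0..<nverts G}. {i, j} \<in> edges G} = nbrs G i"
    using nbrs_subset[OF assms, of i] by (auto simp: nbrs_def)
  then have "(\<Sum>j\<in>nbrs G i. c * f j) =
      (\<Sum>j\<in>{0..<nverts G}. if {i, j} \<in> edges G then c * f j else 0)"
    by (simp add: sum.inter_filter[symmetric])
  also have "\<dots> = (\<Sum>j\<in>{0..<nverts G}. (if {i, j} \<in> edges G then c else 0) * f j)"
    by (intro sum.cong) auto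
  finally show ?thesis ..
qed

lemma adjacency_matrix_mult:
  assumes "simple_graph G" "v \<in> carrier_vec (nverts G)" "i < nverts G"
  shows "vec_index (adjacency_matrix G *\<^sub>v v) i = (\<Sum>j\<in>nbrs G i. vec_index v j)"
proof -
  have "vec_index (adjacency_matrix G *\<^sub>v v) i =
      (\<Sum>j\<in>{0..<nverts G}. (if {i, j} \<in> edges G then 1 else 0) * vec_index v j)"
    using assms(2,3) by (auto simp: adjacency_matrix_def scalar_prod_def intro!: sum.cong)
  also have "\<dots> = (\<Sum>j\<in>nbrs G i. vec_index v j)"
    unfolding sum_adjacent[OF assms(1)] by simp
  finally show ?thesis .
qed

text \<open>Take the moduli of the entries of an eigenvector for an eigenvalue of largest modulus;
  the triangle inequality turns the eigenvalue equation into the stated inequality. This vector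
  replaces the Perron vector.\<close>

lemma spectral_radius_subharmonic:
  assumes "simple_graph G" "nverts G > 0"
  obtains x :: "nat \<Rightarrow> real" where "\<And>i. 0 \<le> x i" "\<exists>i<nverts G. x i > 0"
    "\<And>i. i < nverts G \<Longrightarrow> graph_spectral_radius G * x i \<le> (\<Sum>j\<in>nbrs G i. x j)"
proof -
  let ?A = "adjacency_matrix G"
  obtain k where k: "k \<in> spectrum ?A" "graph_spectral_radius G = norm k"
    using spectral_radius_mem_max(1)[OF adjacency_matrix_carrier assms(2)]
    by (auto simp: graph_spectral_radius_def)
  then obtain v where "eigenvector ?A v k"
    by (auto simp: spectrum_def eigenvalue_def)
  then have v: "v \<in> carrier_vec (nverts G)" "v \<noteq> 0\<^sub>v (nverts G)" "?A *\<^sub>v v = k \<cdot>\<^sub>v v"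
    by (auto simp: eigenvector_def adjacency_matrix_def)
  show ?thesis
  proof (rule that[of "\<lambda>i. norm (vec_index v i)"])
    show "\<exists>i<nverts G. norm (vec_index v i) > 0"
      using v(1,2) by (metis carrier_vecD eq_vecI index_zero_vec zero_less_norm_iff)
    fix i assume i: "i < nverts G"
    have "k * vec_index v i = (\<Sum>j\<in>nbrs G i. vec_index v j)"
      using arg_cong[OF v(3), of "\<lambda>u. vec_index u i"] i v(1) adjacency_matrix_mult[OF assms(1) v(1) i] by simp
    then have "norm k * norm (vec_index v i) = norm (\<Sum>j\<in>nbrs G i. vec_index v j)"
      by (metis norm_mult)
    also have "\<dots> \<le> (\<Sum>j\<in>nbrs G i. norm (vec_index v j))"
      by (rule norm_sum)
    finally show "graph_spectral_radius G * norm (vec_index v i) \<le> (\<Sum>j\<in>nbrs G i. norm (vec_index v j))"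
      using k by simp
  qed auto
qed

text \<open>Nonnegativity of the powers is part of the induction because the inequality for
  \<open>R\<close> is multiplied by the entries of the k-th power.\<close>

lemma pow_mat_superharmonic:
  fixes R :: "real mat"
  assumes R: "R \<in> carrier_mat n n" "\<And>i j. i < n \<Longrightarrow> j < n \<Longrightarrow> 0 \<le> R $$ (i, j)"
    and q: "0 \<le> q" "\<And>i. i < n \<Longrightarrow> q * y i \<le> (\<Sum>j<n. R $$ (i, j) * y j)"
  shows "(\<forall>i<n. \<forall>j<n. 0 \<le> (R ^\<^sub>m k) $$ (i, j)) \<and>
    (\<forall>i<n. q ^ k * y i \<le> (\<Sum>j<n. (R ^\<^sub>m k) $$ (i, j) * y j))"
proof (induction k)
  case 0
  have "(\<Sum>j<n. (1\<^sub>m n :: real mat) $$ (i, j) * y j) = (\<Sum>j<n. if j = i then y j else 0)" if "i < n" for i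
    using that by (intro sum.cong) auto
  then show ?case
    using R(1) by auto
next
  case (Suc k)
  have P: "R ^\<^sub>m k \<in> carrier_mat n n"
    using R(1) by simp
  have e: "(R ^\<^sub>m Suc k) $$ (i, j) = (\<Sum>l<n. (R ^\<^sub>m k) $$ (i, l) * R $$ (l, j))" if "i < n" "j < n" for i j
    using that R(1) P by (simp add: scalar_prod_def atLeast0LessThan)
  show ?case
  proof (intro conjI allI impI)
    fix i j assume "i < n" "j < n"
    then show "0 \<le> (R ^\<^sub>m Suc k) $$ (i, j)"
      unfolding e[OF \<open>i < n\<close> \<open>j < n\<close>] using Suc R(2) by (intro sum_nonneg mult_nonneg_nonneg) auto
  next
    fix i assume i: "i < n"
    have "q ^ Suc k * y i \<le> q * (\<Sum>l<n. (R ^\<^sub>m k) $$ (i, l) * y l)"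
      using Suc i q(1) by (simp add: mult.assoc mult_left_mono)
    also have "\<dots> = (\<Sum>l<n. (R ^\<^sub>m k) $$ (i, l) * (q * y l))"
      by (simp add: sum_distrib_left mult_ac)
    also have "\<dots> \<le> (\<Sum>l<n. (R ^\<^sub>m k) $$ (i, l) * (\<Sum>j<n. R $$ (l, j) * y j))"
      using Suc i q(2) by (intro sum_mono mult_left_mono) auto
    also have "\<dots> = (\<Sum>l<n. \<Sum>j<n. (R ^\<^sub>m k) $$ (i, l) * R $$ (l, j) * y j)"
      by (simp add: sum_distrib_left mult.assoc)
    also have "\<dots> = (\<Sum>j<n. \<Sum>l<n. (R ^\<^sub>m k) $$ (i, l) * R $$ (l, j) * y j)"
      by (rule sum.swap)
    also have "\<dots> = (\<Sum>j<n. (R ^\<^sub>m Suc k) $$ (i, j) * y j)"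
      using e[OF i] by (intro sum.cong) (simp_all add: sum_distrib_right)
    finally show "q ^ Suc k * y i \<le> (\<Sum>j<n. (R ^\<^sub>m Suc k) $$ (i, j) * y j)" .
  qed
qed

text \<open>If the spectral radius were smaller, the powers of a suitably scaled adjacency matrix would
  be bounded, while their action on \<open>y\<close> grows geometrically.\<close>

lemma spectral_radius_ge_superharmonic:
  fixes y :: "nat \<Rightarrow> real"
  assumes G: "simple_graph G"
    and y: "\<And>i. i < nverts G \<Longrightarrow> 0 \<le> y i" "i0 < nverts G" "y i0 > 0"
    and sup: "\<And>i. i < nverts G \<Longrightarrow> \<mu> * y i \<le> (\<Sum>j\<in>nbrs G i. y j)"
  shows "\<mu> \<le> graph_spectral_radius G"
proof (rule ccontr)
  let ?n = "nverts G" and ?\<rho> = "graph_spectral_radius G" and ?A = "adjacency_matrix G"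
  assume less: "\<not> \<mu> \<le> ?\<rho>"
  \<comment> \<open>Any value strictly between the two serves: dividing by \<nu> pushes the spectral
    radius below 1, so that powers stay bounded, but leaves the growth factor \<mu> / \<nu> above
    1.\<close>
  define \<nu> where "\<nu> = (?\<rho> + \<mu>) / 2"
  have n: "?n > 0" using y(2) by simp
  note mem = spectral_radius_mem_max[OF adjacency_matrix_carrier n, folded graph_spectral_radius_def]
  have "0 \<le> ?\<rho>" using mem(1) by auto
  with less have nu: "?\<rho> < \<nu>" "\<nu> < \<mu>" "0 < \<nu>"
    by (auto simp: \<nu>_def)
  \<comment> \<open>The growth estimate needs an ordered field and the norm bound complex entries,
    so the scaled matrix exists as the real \<open>R\<close> and as its complex copy
    \<open>B\<close>.\<close>
  define R where "R = mat ?n ?n (\<lambda>(i, j). if {i, j} \<in> edges G then 1 / \<nu> else 0)"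
  have R: "R \<in> carrier_mat ?n ?n" by (simp add: R_def)
  define B where "B = map_mat complex_of_real R"
  have B: "B \<in> carrier_mat ?n ?n" by (simp add: B_def R)
  have AB: "?A = of_real \<nu> \<cdot>\<^sub>m B"
    using nu(3) by (intro eq_matI) (auto simp: adjacency_matrix_def B_def R_def)
  have "spectral_radius B < 1"
  proof -
    obtain k where k: "k \<in> spectrum B" "spectral_radius B = norm k"
      using spectral_radius_mem_max(1)[OF B n] by auto
    then obtain v where v: "eigenvector B v k"
      by (auto simp: spectrum_def eigenvalue_def)
    then have v': "v \<in> carrier_vec ?n" "v \<noteq> 0\<^sub>v ?n" "B *\<^sub>v v = k \<cdot>\<^sub>v v"
      using B by (auto simp: eigenvector_def)
    have "?A *\<^sub>v v = of_real \<nu> \<cdot>\<^sub>v (B *\<^sub>v v)"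
      unfolding AB using B v'(1) by (intro eq_vecI) auto
    then have "eigenvector ?A v (of_real \<nu> * k)"
      using v' by (simp add: eigenvector_def adjacency_matrix_def smult_smult_assoc)
    then have "norm (of_real \<nu> * k) \<le> ?\<rho>"
      by (intro mem(2) imageI) (unfold spectrum_def eigenvalue_def, blast)
    then have "\<nu> * norm k < \<nu> * 1"
      using nu by (simp only: norm_mult norm_of_real)
    then have "norm k < 1"
      using mult_less_cancel_left_pos[OF nu(3)] by blast
    then show ?thesis
      using k(2) by simp
  qed
  then obtain c where c: "\<And>k. norm_bound (B ^\<^sub>m k) c"
    using spectral_radius_jnf_norm_bound_less_1_upper_triangular[OF B] by blast
  have RA: "(\<Sum>j<?n. R $$ (i, j) * y j) = (\<Sum>j\<in>nbrs G i. 1 / \<nu> * y j)" if "i < ?n" for i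
    unfolding sum_adjacent[OF G, symmetric] atLeast0LessThan
    using that by (intro sum.cong) (auto simp: R_def)
  have "\<mu> / \<nu> * y i \<le> (\<Sum>j<?n. R $$ (i, j) * y j)" if "i < ?n" for i
    unfolding RA[OF that] sum_distrib_left[symmetric] using sup[OF that] nu(3)
    by (simp add: divide_right_mono)
  moreover have "0 \<le> R $$ (i, j)" if "i < ?n" "j < ?n" for i j
    using that nu(3) by (simp add: R_def)
  ultimately have pow: "(\<mu> / \<nu>) ^ k * y i0 \<le> (\<Sum>j<?n. (R ^\<^sub>m k) $$ (i0, j) * y j)" for k
    using pow_mat_superharmonic[OF R, of "\<mu> / \<nu>" y k] nu y(2) by auto
  have bound: "(R ^\<^sub>m k) $$ (i0, j) \<le> c" if "j < ?n" for k j
  proof -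
    have "B ^\<^sub>m k = map_mat complex_of_real (R ^\<^sub>m k)"
      unfolding B_def by (rule of_real_hom.mat_hom_pow[OF R, symmetric])
    then have "norm (complex_of_real ((R ^\<^sub>m k) $$ (i0, j))) \<le> c"
      using c[of k] that y(2) R unfolding norm_bound_def by auto
    then show ?thesis by simp
  qed
  have le: "(\<mu> / \<nu>) ^ k * y i0 \<le> c * (\<Sum>j<?n. y j)" for k
  proof -
    have "(\<Sum>j<?n. (R ^\<^sub>m k) $$ (i0, j) * y j) \<le> (\<Sum>j<?n. c * y j)"
      using bound y(1) by (intro sum_mono mult_right_mono) auto
    with pow[of k] show ?thesis by (simp add: sum_distrib_left)
  qed
  have "1 < \<mu> / \<nu>" using nu by simp
  then obtain k where "c * (\<Sum>j<?n. y j) / y i0 < (\<mu> / \<nu>) ^ k"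
    using real_arch_pow by blast
  then have "c * (\<Sum>j<?n. y j) < (\<mu> / \<nu>) ^ k * y i0"
    using y(3) by (simp add: pos_divide_less_eq)
  with le[of k] show False by simp
qed

text \<open>A vector with A x >= \<rho> x for \<open>G\<close>, transported along the isomorphism,
  is a certificate for \<open>H\<close>.\<close>

lemma graph_iso_spectral_radius_le:
  assumes "graph_iso G H" "simple_graph G" "simple_graph H" "nverts G > 0"
  shows "graph_spectral_radius G \<le> graph_spectral_radius H"
proof -
  obtain f where f: "bij_betw f {..<nverts G} {..<nverts H}"
    "\<And>u v. u < nverts G \<Longrightarrow> v < nverts G \<Longrightarrow> {u, v} \<in> edges G \<longleftrightarrow> {f u, f v} \<in> edges H"
    using assms(1) unfolding graph_iso_def by blast
  define g where "g = inv_into {..<nverts G} f"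
  have gf: "g (f i) = i" if "i < nverts G" for i
    using f(1) that by (simp add: g_def bij_betw_def)
  have nb: "nbrs H (f i) = f ` nbrs G i" if i: "i < nverts G" for i
  proof (intro equalityI subsetI)
    fix u assume u: "u \<in> nbrs H (f i)"
    then have "u \<in> f ` {..<nverts G}"
      using nbrs_subset[OF assms(3), of "f i"] f(1) by (auto simp: bij_betw_def)
    then obtain j where "j < nverts G" "u = f j" by blast
    then show "u \<in> f ` nbrs G i"
      using f(2)[OF i, of j] u by (simp add: nbrs_def)
  next
    fix u assume "u \<in> f ` nbrs G i"
    then obtain j where j: "u = f j" "j \<in> nbrs G i" by blast
    then have "j < nverts G" using nbrs_subset[OF assms(2), of i] by blast
    then show "u \<in> nbrs H (f i)"
      using f(2)[OF i, of j] j by (simp add: nbrs_def)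
  qed
  obtain x where x: "\<And>i. (0::real) \<le> x i" "\<exists>i<nverts G. x i > 0"
    "\<And>i. i < nverts G \<Longrightarrow> graph_spectral_radius G * x i \<le> (\<Sum>j\<in>nbrs G i. x j)"
    using spectral_radius_subharmonic[OF assms(2,4)] by metis
  obtain i0 where i0: "i0 < nverts G" "x i0 > 0" using x(2) by blast
  show ?thesis
  proof (rule spectral_radius_ge_superharmonic[OF assms(3), of "\<lambda>u. x (g u)" "f i0"])
    fix u assume "u < nverts H"
    then obtain i where i: "i < nverts G" "u = f i"
      using f(1) unfolding bij_betw_def by (metis imageE lessThan_iff)
    have sub: "nbrs G i \<subseteq> {..<nverts G}"
      using nbrs_subset[OF assms(2)] by blast
    have "(\<Sum>v\<in>nbrs H u. x (g v)) = (\<Sum>j\<in>nbrs G i. x (g (f j)))"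
      unfolding i(2) nb[OF i(1)] using f(1) sub
      by (intro sum.reindex[unfolded comp_def]) (auto simp: bij_betw_def inj_on_def)
    also have "\<dots> = (\<Sum>j\<in>nbrs G i. x j)"
      using sub by (intro sum.cong) (auto simp: gf)
    finally show "graph_spectral_radius G * x (g u) \<le> (\<Sum>v\<in>nbrs H u. x (g v))"
      using x(3)[OF i(1)] i gf by simp
  qed (use x i0 gf f(1) in \<open>auto simp: bij_betw_def\<close>)
qed

section \<open>Existence of a dominating vertex\<close>

lemma sum_card_swap:
  assumes "finite A" "finite B"
  shows "(\<Sum>a\<in>A. card {b \<in> B. R a b}) = (\<Sum>b\<in>B. card {a \<in> A. R a b})"
  using sum_multicount_gen[OF assms, of R "\<lambda>b. card {a \<in> A. R a b}"] by simp

text \<open>The threshold \<open>big\<close> is a sum of two parts: 4 t^2 + 8 t^2 / \<rho> + 2 t + 2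
  is lost in estimating the second largest entry m, and the remaining 8 t + 2 gives (8 t + 2) m < 1,
  which the final count needs. The set \<open>S\<close> is a vertex cover.\<close>

lemma dominating_vertex:
  fixes G :: graph and t :: nat
  defines "\<rho> \<equiv> graph_spectral_radius G"
  assumes G: "simple_graph G" and n: "nverts G > 0"
    and common: "\<And>a b. a \<noteq> b \<Longrightarrow> card (nbrs G a \<inter> nbrs G b) \<le> 2"
    and S: "finite S" "card S \<le> 2 * t" "\<And>u v. {u, v} \<in> edges G \<Longrightarrow> u \<in> S \<or> v \<in> S"
    and rho: "real (nverts G) - 1 \<le> \<rho>\<^sup>2" "\<rho> > 0"
    and big: "\<rho> > 4 * real t ^ 2 + 10 * real t + 4 + 8 * real t ^ 2 / \<rho>"
  shows "\<exists>z<nverts G. nbrs G z = {..<nverts G} - {z}"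
proof -
  define V where "V = {..<nverts G}"
  let ?N = "nbrs G"
  have fV: "finite V" by (simp add: V_def)
  have N: "?N v \<subseteq> V - {v}" for v
    using nbrs_subset[OF G] by (simp add: V_def)
  have fN: "finite (?N v)" for v by (rule finite_nbrs[OF G])
  have NS: "?N w \<subseteq> S" if "w \<notin> S" for w
    using S(3) that by (auto simp: nbrs_def)
  obtain x where x: "\<And>i. (0::real) \<le> x i" "\<exists>i<nverts G. x i > 0"
    "\<And>i. i < nverts G \<Longrightarrow> \<rho> * x i \<le> (\<Sum>j\<in>?N i. x j)"
    using spectral_radius_subharmonic[OF G n] unfolding \<rho>_def by metis
  obtain z where z: "z \<in> V" "\<And>i. i \<in> V \<Longrightarrow> x i \<le> x z"
  proof -
    have "Max (x ` V) \<in> x ` V" using fV n by (intro Max_in) (auto simp: V_def)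
    then obtain z where "z \<in> V" "x z = Max (x ` V)" by auto
    with that[of z] show ?thesis using fV by auto
  qed
  have xz: "x z > 0"
    using x(2) z(2) by (force simp: V_def)
  define y where "y i = x i / x z" for i
  have y: "0 \<le> y i" for i using x(1) xz by (simp add: y_def)
  have y1: "y i \<le> 1" if "i \<in> V" for i using z(2)[OF that] xz by (simp add: y_def)
  have yz: "y z = 1" using xz by (simp add: y_def)
  have ysub: "\<rho> * y i \<le> (\<Sum>j\<in>?N i. y j)" if "i \<in> V" for i
  proof -
    have "\<rho> * x i / x z \<le> (\<Sum>j\<in>?N i. x j) / x z"
      using x(3) that xz by (intro divide_right_mono) (auto simp: V_def)
    then show ?thesis by (simp add: y_def sum_divide_distrib)
  qed
  define R where "R = V - {z} - ?N z"
  define r where "r = real (card R)"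
  have cardV: "real (nverts G) = 1 + real (card (?N z)) + r"
  proof -
    have "V = insert z (?N z \<union> R)" using N[of z] z(1) by (auto simp: R_def)
    moreover have "z \<notin> ?N z \<union> R" "?N z \<inter> R = {}" "finite R"
      using N[of z] fV by (auto simp: R_def)
    ultimately have "card V = Suc (card (?N z) + card R)"
      using fN[of z] by (simp add: card_Un_disjoint)
    then show ?thesis by (simp add: r_def V_def)
  qed
  have rho2: "\<rho>\<^sup>2 \<le> (\<Sum>w\<in>?N z. \<rho> * y w)"
    using ysub[OF z(1)] rho(2) by (simp add: yz power2_eq_square sum_distrib_left[symmetric])
  have cS: "real (card S) \<le> 2 * real t"
    using S(2) by linarith
  have common': "real (card (?N a \<inter> ?N b)) \<le> 2" if "a \<noteq> b" for a b
    using common[OF that] by linarith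
  have sumS: "(\<Sum>w\<in>A. y w) \<le> 2 * real t * c" if "A \<subseteq> S" "\<And>w. w \<in> A \<Longrightarrow> y w \<le> c" "0 \<le> c" for A c
  proof -
    have "(\<Sum>w\<in>A. y w) \<le> real (card A) * c"
      using that(2) by (rule sum_bounded_above)
    also have "\<dots> \<le> 2 * real t * c"
      using card_mono[OF S(1) that(1)] S(2) that(3) by (intro mult_right_mono) linarith+
    finally show ?thesis .
  qed
  \<comment> \<open>In \<rho>^2 <= (sum of \<rho> y over the neighbours of z), those in
    \<open>S\<close> contribute at most 2 t \<rho>. Each other one has all its neighbours in
    \<open>S\<close> and contributes 1 plus its number of neighbours in \<open>S\<close> besides z;
    by double counting these add up to at most 4 t, as each u in \<open>S\<close> shares at most two
    neighbours with z. The left side is at least the degree of z plus r.\<close>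
  have rle: "r \<le> 2 * real t * \<rho> + 4 * real t"
  proof -
    let ?A = "?N z - S"
    have "(\<Sum>w\<in>?N z. \<rho> * y w) = \<rho> * (\<Sum>w\<in>?N z \<inter> S. y w) + (\<Sum>w\<in>?A. \<rho> * y w)"
      using sum.Int_Diff[OF fN, of "\<lambda>w. \<rho> * y w" z S] by (simp add: sum_distrib_left)
    also have "\<rho> * (\<Sum>w\<in>?N z \<inter> S. y w) \<le> \<rho> * (2 * real t * 1)"
      using rho(2) N[of z] y1 by (intro mult_left_mono sumS) auto
    also have "(\<Sum>w\<in>?A. \<rho> * y w) \<le> (\<Sum>w\<in>?A. 1 + real (card {u \<in> S - {z}. u \<in> ?N w}))"
    proof (intro sum_mono)
      fix w assume w: "w \<in> ?A"
      have "\<rho> * y w \<le> (\<Sum>j\<in>?N w. y j)"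
        using w N[of z] by (intro ysub) auto
      also have "\<dots> = y z + (\<Sum>j\<in>?N w - {z}. y j)"
        using w fN by (intro sum.remove) (auto simp: nbrs_sym)
      also have "(\<Sum>j\<in>?N w - {z}. y j) \<le> real (card (?N w - {z})) * 1"
        using N[of w] y1 by (intro sum_bounded_above) auto
      also have "?N w - {z} = {u \<in> S - {z}. u \<in> ?N w}"
        using NS[of w] w by auto
      finally show "\<rho> * y w \<le> 1 + real (card {u \<in> S - {z}. u \<in> ?N w})"
        by (simp add: yz)
    qed
    also have "\<dots> = real (card ?A) + real (\<Sum>w\<in>?A. card {u \<in> S - {z}. u \<in> ?N w})"
      by (simp add: sum.distrib)
    also have "(\<Sum>w\<in>?A. card {u \<in> S - {z}. u \<in> ?N w}) = (\<Sum>u\<in>S - {z}. card {w \<in> ?A. u \<in> ?N w})"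
      using fN S(1) by (intro sum_card_swap) auto
    also have "real (\<Sum>u\<in>S - {z}. card {w \<in> ?A. u \<in> ?N w}) \<le> (\<Sum>u\<in>S - {z}. 2)"
      unfolding of_nat_sum
    proof (intro sum_mono)
      fix u assume "u \<in> S - {z}"
      then have "real (card (?N z \<inter> ?N u)) \<le> 2" by (intro common') auto
      moreover have "card {w \<in> ?A. u \<in> ?N w} \<le> card (?N z \<inter> ?N u)"
        using fN by (intro card_mono) (auto simp: nbrs_sym)
      ultimately show "real (card {w \<in> ?A. u \<in> ?N w}) \<le> 2" by linarith
    qed
    also have "(\<Sum>u\<in>S - {z}. 2::real) \<le> 4 * real t"
      using cS card_mono[of S "S - {z}"] S(1) by auto
    also have "real (card ?A) \<le> real (card (?N z))"
      using fN by (simp add: card_mono)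
    finally have "(\<Sum>w\<in>?N z. \<rho> * y w) \<le> \<rho> * (2 * real t) + real (card (?N z)) + 4 * real t"
      by simp
    then show ?thesis
      using rho2 rho(1) cardV by (simp add: mult_ac)
  qed
  have "R = {}"
  proof (rule ccontr)
    assume "R \<noteq> {}"
    then have ne: "V - {z} \<noteq> {}" by (auto simp: R_def)
    have r1: "r \<ge> 1"
      using \<open>R \<noteq> {}\<close> fV by (simp add: r_def R_def Suc_le_eq card_gt_0_iff)
    define m where "m = Max (y ` (V - {z}))"
    have ym: "y i \<le> m" if "i \<in> V - {z}" for i
      using that fV by (auto simp: m_def)
    have "m \<in> y ` (V - {z})"
      unfolding m_def using fV ne by (intro Max_in) auto
    then obtain v where v: "v \<in> V - {z}" "y v = m" by auto
    have m0: "0 \<le> m" using v(2) y by auto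
    \<comment> \<open>A non-neighbour of z outside \<open>S\<close> sees only vertices of
      \<open>S\<close> other than z, so its entry is smaller than m by a factor of order t /
      \<rho>.\<close>
    have yR: "y w \<le> 2 * real t * m / \<rho>" if "w \<in> R" "w \<notin> S" for w
    proof -
      have "\<rho> * y w \<le> (\<Sum>j\<in>?N w. y j)"
        using that by (intro ysub) (auto simp: R_def)
      also have "\<dots> \<le> 2 * real t * m"
      proof (rule sumS[OF NS[OF that(2)] _ m0])
        fix u assume "u \<in> ?N w"
        moreover from this have "u \<noteq> z" using that(1) by (auto simp: R_def nbrs_sym)
        ultimately show "y u \<le> m" using N[of w] by (intro ym) auto
      qed
      finally show ?thesis using rho(2) by (simp add: field_simps)
    qed
    \<comment> \<open>The neighbours of v are split into z, members of \<open>S\<close>, common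
      neighbours with z, and non-neighbours of z outside \<open>S\<close>. The last class may be
      large, but \<open>rle\<close> and \<open>yR\<close> bound its total by a multiple of m of
      order t^2.\<close>
    have "\<rho> * m \<le> (\<Sum>j\<in>?N v. y j)"
      using ysub[of v] v by auto
    also have "\<dots> \<le> 1 + (\<Sum>j\<in>?N v - {z}. y j)"
      using sum.remove[OF fN, of z v y] y1[OF z(1)] by (cases "z \<in> ?N v") (auto simp: yz)
    also have "(\<Sum>j\<in>?N v - {z}. y j) =
        (\<Sum>j\<in>(?N v - {z}) \<inter> S. y j) + (\<Sum>j\<in>?N v - {z} - S. y j)"
      using fN by (intro sum.Int_Diff) auto
    also have "(\<Sum>j\<in>(?N v - {z}) \<inter> S. y j) \<le> 2 * real t * m"
      using N[of v] by (intro sumS[OF _ _ m0] ym) auto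
    also have "(\<Sum>j\<in>?N v - {z} - S. y j) =
        (\<Sum>j\<in>(?N v - {z} - S) \<inter> ?N z. y j) + (\<Sum>j\<in>?N v - {z} - S - ?N z. y j)"
      using fN by (intro sum.Int_Diff) auto
    also have "(\<Sum>j\<in>(?N v - {z} - S) \<inter> ?N z. y j) \<le> 2 * m"
    proof -
      have "(\<Sum>j\<in>(?N v - {z} - S) \<inter> ?N z. y j) \<le> real (card ((?N v - {z} - S) \<inter> ?N z)) * m"
        using N[of v] by (intro sum_bounded_above ym) auto
      also have "\<dots> \<le> real (card (?N v \<inter> ?N z)) * m"
        using fN m0 by (intro mult_right_mono of_nat_mono card_mono) auto
      also have "\<dots> \<le> 2 * m"
        using common'[of v z] v(1) m0 by (intro mult_right_mono) auto
      finally show ?thesis .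
    qed
    also have "(\<Sum>j\<in>?N v - {z} - S - ?N z. y j) \<le> r * (2 * real t * m / \<rho>)"
    proof -
      have sub: "?N v - {z} - S - ?N z \<subseteq> R - S" using N[of v] by (auto simp: R_def)
      have "(\<Sum>j\<in>?N v - {z} - S - ?N z. y j) \<le> real (card (?N v - {z} - S - ?N z)) * (2 * real t * m / \<rho>)"
        using sub by (intro sum_bounded_above yR) auto
      also have "\<dots> \<le> r * (2 * real t * m / \<rho>)"
        unfolding r_def using m0 rho(2) sub fV
        by (intro mult_right_mono of_nat_mono card_mono) (auto simp: R_def)
      finally show ?thesis .
    qed
    also have "r * (2 * real t * m / \<rho>) \<le> (2 * real t * \<rho> + 4 * real t) * (2 * real t * m / \<rho>)"
      using rle m0 rho(2) by (intro mult_right_mono) auto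
    also have "\<dots> = (4 * real t ^ 2 + 8 * real t ^ 2 / \<rho>) * m"
      using rho(2) by (simp add: field_simps power2_eq_square)
    finally have Dm: "(\<rho> - (4 * real t ^ 2 + 8 * real t ^ 2 / \<rho> + 2 * real t + 2)) * m \<le> 1"
      by (simp add: algebra_simps)
    have m1: "(8 * real t + 2) * m < 1"
    proof (cases "m = 0")
      case False
      then have "(8 * real t + 2) * m < (\<rho> - (4 * real t ^ 2 + 8 * real t ^ 2 / \<rho> + 2 * real t + 2)) * m"
        using big m0 by (intro mult_strict_right_mono) linarith+
      with Dm show ?thesis by linarith
    qed simp

    let ?A = "?N z"
    have common2: "(\<Sum>u\<in>B. card (?A \<inter> ?N u)) \<le> card B * 2" if "z \<notin> B" for B
    proof -
      have "card (?A \<inter> ?N u) \<le> 2" if "u \<in> B" for u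
        using \<open>z \<notin> B\<close> that by (intro common) auto
      then have "(\<Sum>u\<in>B. card (?A \<inter> ?N u)) \<le> of_nat (card B) * 2"
        by (rule sum_bounded_above)
      then show ?thesis by simp
    qed
    \<comment> \<open>The walk count at z is repeated with the bound m for every entry other than
      that of z.\<close>
    have "(\<Sum>w\<in>?A. \<rho> * y w) \<le> (\<Sum>w\<in>?A. 1 + m * real (card {u \<in> V - {z}. u \<in> ?N w}))"
    proof (intro sum_mono)
      fix w assume w: "w \<in> ?A"
      have "\<rho> * y w \<le> (\<Sum>j\<in>?N w. y j)"
        using w N[of z] by (intro ysub) auto
      also have "\<dots> = y z + (\<Sum>j\<in>?N w - {z}. y j)"
        using w fN by (intro sum.remove) (auto simp: nbrs_sym)
      also have "(\<Sum>j\<in>?N w - {z}. y j) \<le> real (card (?N w - {z})) * m"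
        using N[of w] by (intro sum_bounded_above ym) auto
      also have "?N w - {z} = {u \<in> V - {z}. u \<in> ?N w}"
        using N[of w] by auto
      finally show "\<rho> * y w \<le> 1 + m * real (card {u \<in> V - {z}. u \<in> ?N w})"
        by (simp add: yz mult_ac)
    qed
    also have "\<dots> = real (card ?A) + m * real (\<Sum>w\<in>?A. card {u \<in> V - {z}. u \<in> ?N w})"
      by (simp add: sum.distrib sum_distrib_left)
    also have "(\<Sum>w\<in>?A. card {u \<in> V - {z}. u \<in> ?N w}) = (\<Sum>u\<in>V - {z}. card {w \<in> ?A. u \<in> ?N w})"
      using fN fV by (intro sum_card_swap) auto
    also have "(\<Sum>u\<in>V - {z}. card {w \<in> ?A. u \<in> ?N w}) = (\<Sum>u\<in>V - {z}. card (?A \<inter> ?N u))"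
      by (intro sum.cong refl arg_cong[of _ _ card]) (auto simp: nbrs_sym)
    also have "\<dots> = (\<Sum>u\<in>(V - {z}) \<inter> ?A. card (?A \<inter> ?N u)) + (\<Sum>u\<in>R. card (?A \<inter> ?N u))"
      unfolding R_def using fV by (intro sum.Int_Diff) auto
    also have "(V - {z}) \<inter> ?A = ?A"
      using N[of z] by auto
    \<comment> \<open>The first sum counts ordered adjacent pairs of neighbours of z. One member of
      each pair is in \<open>S\<close>, and each vertex of \<open>S\<close> among the neighbours of
      z has at most two neighbours there; this gives 4 t for either position. A vertex of
      \<open>R\<close> shares at most two neighbours with z.\<close>
    also have "real ((\<Sum>u\<in>?A. card (?A \<inter> ?N u)) + (\<Sum>u\<in>R. card (?A \<inter> ?N u))) \<le> 8 * real t + 2 * r"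
    proof -
      have "(\<Sum>u\<in>R. card (?A \<inter> ?N u)) \<le> card R * 2"
        using common2[of R] by (auto simp: R_def)
      moreover have half: "(\<Sum>u\<in>?A \<inter> S. card (?A \<inter> ?N u)) \<le> 4 * t"
      proof -
        have "(\<Sum>u\<in>?A \<inter> S. card (?A \<inter> ?N u)) \<le> card (?A \<inter> S) * 2"
          using N[of z] by (intro common2) auto
        also have "card (?A \<inter> S) \<le> 2 * t"
          using S(1,2) card_mono[of S "?A \<inter> S"] by auto
        finally show ?thesis by simp
      qed
      moreover have "(\<Sum>u\<in>?A - S. card (?A \<inter> ?N u)) \<le> 4 * t"
      proof -
        have "(\<Sum>u\<in>?A - S. card (?A \<inter> ?N u)) = (\<Sum>u\<in>?A - S. card {w \<in> ?A \<inter> S. w \<in> ?N u})"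
          using NS by (intro sum.cong refl arg_cong[of _ _ card]) auto
        also have "\<dots> = (\<Sum>w\<in>?A \<inter> S. card {u \<in> ?A - S. w \<in> ?N u})"
          using fN by (intro sum_card_swap) auto
        also have "\<dots> \<le> (\<Sum>w\<in>?A \<inter> S. card (?A \<inter> ?N w))"
          using fN by (intro sum_mono card_mono) (auto simp: nbrs_sym)
        finally show ?thesis using half by linarith
      qed
      moreover have "(\<Sum>u\<in>?A. card (?A \<inter> ?N u)) =
          (\<Sum>u\<in>?A \<inter> S. card (?A \<inter> ?N u)) + (\<Sum>u\<in>?A - S. card (?A \<inter> ?N u))"
        using fN by (intro sum.Int_Diff) auto
      ultimately have "(\<Sum>u\<in>?A. card (?A \<inter> ?N u)) + (\<Sum>u\<in>R. card (?A \<inter> ?N u)) \<le> 8 * t + 2 * card R"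
        by linarith
      then show ?thesis unfolding r_def by linarith
    qed
    finally have "(\<Sum>w\<in>?A. \<rho> * y w) \<le> real (card ?A) + m * (8 * real t + 2 * r)"
      using m0 by (simp add: mult_left_mono)
    \<comment> \<open>Since r is at least 1, the term 8 t is absorbed into 8 t r, and (8 t + 2) m <
      1 then yields r < r.\<close>
    then have "r \<le> m * (8 * real t + 2 * r)"
      using rho2 rho(1) cardV by linarith
    also have "\<dots> \<le> m * ((8 * real t + 2) * r)"
      using m0 mult_left_mono[OF r1, of "real t"] by (intro mult_left_mono) (auto simp: algebra_simps)
    also have "\<dots> = ((8 * real t + 2) * m) * r" by simp
    also have "\<dots> < 1 * r"
      using m1 r1 by (intro mult_strict_right_mono) auto
    finally show False by simp
  qed
  then have "?N z = V - {z}"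
    using N[of z] by (auto simp: R_def)
  with z(1) show ?thesis by (auto simp: V_def)
qed

section \<open>Linear forests\<close>

lemma walk_edges_rev: "walk_edges (rev vs) = walk_edges vs"
proof (induction vs rule: walk_edges.induct)
  case (1 a b vs)
  then show ?case
    using walk_edges_snoc[of "rev vs @ [b]" a] by (simp add: insert_commute)
qed auto

lemma walk_edges_nth: "walk_edges vs = {{vs ! i, vs ! Suc i} | i. Suc i < length vs}"
proof (induction vs rule: walk_edges.induct)
  case (1 a b vs)
  have "{{(a # b # vs) ! i, (a # b # vs) ! Suc i} | i. Suc i < length (a # b # vs)} =
    insert {a, b} {{(b # vs) ! i, (b # vs) ! Suc i} | i. Suc i < length (b # vs)}" (is "?L = ?R")
  proof (intro equalityI subsetI)
    fix e assume "e \<in> ?L"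
    then obtain i where "e = {(a # b # vs) ! i, (a # b # vs) ! Suc i}" "Suc i < length (a # b # vs)"
      by blast
    then show "e \<in> ?R" by (cases i) auto
  next
    fix e assume "e \<in> ?R"
    then consider "e = {a, b}" | i where "e = {(b # vs) ! i, (b # vs) ! Suc i}" "Suc i < length (b # vs)"
      by blast
    then show "e \<in> ?L"
    proof cases
      case 1 then show ?thesis by (intro CollectI exI[of _ 0]) auto
    next
      case (2 i) then show ?thesis by (intro CollectI exI[of _ "Suc i"]) auto
    qed
  qed
  with 1 show ?case by simp
qed auto

lemma finite_walk_edges: "finite (walk_edges vs)"
  by (induction vs rule: walk_edges.induct) auto

lemma card_walk_edges: "distinct vs \<Longrightarrow> card (walk_edges vs) = length vs - 1"
proof (induction vs rule: walk_edges.induct)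
  case (1 a b vs)
  then have "{a, b} \<notin> walk_edges (b # vs)"
    using walk_edges_subset[of "{a, b}" "b # vs"] by auto
  with 1 show ?case by (simp add: finite_walk_edges)
qed auto

lemma walk_edges_take: "walk_edges (take k vs) \<subseteq> walk_edges vs"
  unfolding walk_edges_nth by force

text \<open>A cycle is a path together with a closing edge; the length bound 3 keeps a single edge
  from closing on itself.\<close>

definition acyclic_graph :: "graph \<Rightarrow> bool" where
  "acyclic_graph G \<longleftrightarrow> (\<forall>vs. distinct vs \<longrightarrow> length vs \<ge> 3 \<longrightarrow> walk_edges vs \<subseteq> edges G \<longrightarrow>
     {last vs, hd vs} \<notin> edges G)"

definition linear_forest :: "graph \<Rightarrow> bool" where
  "linear_forest G \<longleftrightarrow> simple_graph G \<and> acyclic_graph G \<and> (\<forall>v. card (nbrs G v) \<le> 2)"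

definition leaves :: "graph \<Rightarrow> nat set" where
  "leaves G = {v. card (nbrs G v) = 1}"

lemma finite_edges: "simple_graph G \<Longrightarrow> finite (edges G)"
  by (rule finite_subset[of _ "Pow {..<nverts G}"]) (auto simp: simple_graph_def)

lemma leaves_subset: "simple_graph G \<Longrightarrow> leaves G \<subseteq> {..<nverts G}"
proof
  fix v assume "simple_graph G" "v \<in> leaves G"
  then obtain u where "u \<in> nbrs G v" by (auto simp: leaves_def card_1_singleton_iff)
  then show "v \<in> {..<nverts G}"
    using nbrs_subset[OF \<open>simple_graph G\<close>, of u] by (auto simp: nbrs_sym)
qed

lemma edge_obtain:
  assumes "simple_graph G" "e \<in> edges G" "v \<in> e"
  obtains u where "e = {v, u}" "u \<noteq> v" "u \<in> nbrs G v"
proof -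
  from assms obtain a b where "e = {a, b}" "a \<noteq> b"
    unfolding simple_graph_def by (metis card_2_iff)
  then show ?thesis
    using that[of a] that[of b] assms(2,3) by (auto simp: nbrs_def insert_commute)
qed

lemma walk_set_subset:
  assumes "simple_graph G" "walk_edges vs \<subseteq> edges G" "length vs \<ge> 2"
  shows "set vs \<subseteq> {..<nverts G}"
  using assms Union_walk_edges[of vs] unfolding simple_graph_def by blast

text \<open>A neighbour of the first vertex lies on the path, for otherwise the path could be
  prolonged; a neighbour at position 2 or later would close a cycle.\<close>

lemma longest_walk_hd_nbrs:
  assumes "simple_graph G" "acyclic_graph G"
    and vs: "distinct vs" "length vs \<ge> 2" "walk_edges vs \<subseteq> edges G"
    and longest: "\<And>us. distinct us \<Longrightarrow> walk_edges us \<subseteq> edges G \<Longrightarrow> length us \<le> length vs"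
  shows "nbrs G (hd vs) = {vs ! 1}"
proof (intro equalityI subsetI)
  obtain a b ws where ws: "vs = a # b # ws"
    using vs(2) by (auto simp: numeral_2_eq_2 Suc_le_length_iff)
  fix u assume u: "u \<in> nbrs G (hd vs)"
  then have e: "{u, a} \<in> edges G" by (simp add: ws nbrs_def insert_commute)
  have "u \<in> set vs"
  proof (rule ccontr)
    assume "u \<notin> set vs"
    then have "length (u # vs) \<le> length vs"
      using vs e by (intro longest) (auto simp: ws)
    then show False by simp
  qed
  then obtain i where i: "i < length vs" "vs ! i = u" by (auto simp: in_set_conv_nth)
  have "\<not> i \<ge> 2"
  proof
    assume "i \<ge> 2"
    let ?us = "take (Suc i) vs"
    have "last ?us = u"
      using i by (simp add: take_Suc_conv_app_nth)
    moreover have "hd ?us = a" by (simp add: ws)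
    moreover have "distinct ?us" "length ?us \<ge> 3" "walk_edges ?us \<subseteq> edges G"
      using vs(1,3) i \<open>i \<ge> 2\<close> walk_edges_take[of "Suc i" vs] by auto
    then have "{last ?us, hd ?us} \<notin> edges G"
      using assms(2) unfolding acyclic_graph_def by blast
    ultimately show False using e by simp
  qed
  moreover have "i \<noteq> 0"
    using i ws nbrs_subset[OF assms(1), of "hd vs"] u by auto
  ultimately have "i = 1" by simp
  with i show "u \<in> {vs ! 1}" by simp
next
  obtain a b ws where ws: "vs = a # b # ws"
    using vs(2) by (auto simp: numeral_2_eq_2 Suc_le_length_iff)
  fix u assume "u \<in> {vs ! 1}"
  then show "u \<in> nbrs G (hd vs)" using vs(3) by (auto simp: ws nbrs_def)
qed

text \<open>A longest path is a whole component: its ends have degree one, and an inner vertex has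
  its two permitted neighbours on the path already.\<close>

lemma linear_forest_component:
  assumes "linear_forest G" "edges G \<noteq> {}"
  obtains vs where "distinct vs" "length vs \<ge> 2" "walk_edges vs \<subseteq> edges G"
    "hd vs \<in> leaves G" "last vs \<in> leaves G"
    "\<And>e. e \<in> edges G \<Longrightarrow> e \<inter> set vs \<noteq> {} \<Longrightarrow> e \<in> walk_edges vs"
proof -
  from assms have G: "simple_graph G" "acyclic_graph G" and deg: "\<And>v. card (nbrs G v) \<le> 2"
    by (auto simp: linear_forest_def)
  define P where "P vs \<longleftrightarrow> distinct vs \<and> length vs \<ge> 2 \<and> walk_edges vs \<subseteq> edges G" for vs
  obtain e where e: "e \<in> edges G" using assms(2) by blast
  then obtain a b where ab: "e = {a, b}" "a \<noteq> b"
    using G(1) unfolding simple_graph_def by (metis card_2_iff)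
  have "P [a, b]" using ab e by (auto simp: P_def)
  moreover have bound: "\<forall>vs. P vs \<longrightarrow> length vs \<le> nverts G"
  proof (intro allI impI)
    fix vs assume "P vs"
    then have "card (set vs) \<le> card {..<nverts G}"
      using walk_set_subset[OF G(1)] by (intro card_mono) (auto simp: P_def)
    with \<open>P vs\<close> show "length vs \<le> nverts G" by (simp add: P_def distinct_card)
  qed
  ultimately obtain vs where vs: "P vs" "\<And>us. P us \<Longrightarrow> length us \<le> length vs"
    using ex_has_greatest_nat[of P "[a, b]" length "Suc (nverts G)"] by (auto simp: less_Suc_eq_le)
  then have v: "distinct vs" "length vs \<ge> 2" "walk_edges vs \<subseteq> edges G"
    by (auto simp: P_def)
  have longest: "length us \<le> length vs" if "distinct us" "walk_edges us \<subseteq> edges G" for us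
    using vs(2)[of us] v(2) that by (cases "length us \<ge> 2") (auto simp: P_def)
  note h = longest_walk_hd_nbrs[OF G v longest]
  have l: "nbrs G (last vs) = {rev vs ! 1}"
    using longest_walk_hd_nbrs[OF G, of "rev vs"] v longest
    by (simp add: hd_rev walk_edges_rev)
  have nth_rev: "rev vs ! 1 = vs ! (length vs - 2)"
    using v(2) by (simp add: rev_nth numeral_2_eq_2)
  show ?thesis
  proof (rule that[OF v])
    show "hd vs \<in> leaves G" "last vs \<in> leaves G"
      using h l by (simp_all add: leaves_def)
    fix e assume e: "e \<in> edges G" "e \<inter> set vs \<noteq> {}"
    then obtain i where i: "i < length vs" "vs ! i \<in> e" by (auto simp: in_set_conv_nth)
    obtain u where u: "e = {vs ! i, u}" "u \<in> nbrs G (vs ! i)"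
      using edge_obtain[OF G(1) e(1) i(2)] by blast
    consider "i = 0" | "i = length vs - 1" | "0 < i" "Suc i < length vs"
      using i by linarith
    then show "e \<in> walk_edges vs"
    proof cases
      case 1
      then have "u = vs ! 1" using h u(2) v(2) by (cases vs) auto
      with 1 u v(2) show ?thesis unfolding walk_edges_nth by force
    next
      case 2
      then have "vs ! i = last vs" using v(2) by (subst last_conv_nth) auto
      then have "u = vs ! (length vs - 2)" using l u(2) nth_rev by simp
      moreover have "Suc (length vs - 2) = i" using 2 v(2) by simp
      ultimately have "e = {vs ! (length vs - 2), vs ! Suc (length vs - 2)}"
        using u(1) by (simp add: insert_commute)
      with v(2) show ?thesis unfolding walk_edges_nth by force
    next
      case 3
      then obtain j where j: "i = Suc j" using gr0_implies_Suc by blast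
      have w: "{vs ! j, vs ! i} \<in> walk_edges vs" "{vs ! i, vs ! Suc i} \<in> walk_edges vs"
        using 3 j unfolding walk_edges_nth by auto
      have "{vs ! j, vs ! Suc i} \<subseteq> nbrs G (vs ! i)"
        using w v(3) by (auto simp: nbrs_def insert_commute)
      moreover have "card {vs ! j, vs ! Suc i} = 2"
        using 3 j v(1) by (simp add: nth_eq_iff_index_eq)
      ultimately have "{vs ! j, vs ! Suc i} = nbrs G (vs ! i)"
        using deg[of "vs ! i"] finite_nbrs[OF G(1)] by (intro card_seteq) auto
      with u(2) have "u = vs ! j \<or> u = vs ! Suc i" by blast
      with u(1) w show ?thesis by (auto simp: insert_commute)
    qed
  qed
qed

lemma linear_forest_subgraph:
  assumes G: "linear_forest G" and H: "nverts H = nverts G" "edges H \<subseteq> edges G"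
  shows "linear_forest H"
  unfolding linear_forest_def
proof (intro conjI allI)
  show "simple_graph H"
    using assms by (auto simp: linear_forest_def simple_graph_def)
  show "acyclic_graph H"
    using G H(2) unfolding linear_forest_def acyclic_graph_def by (meson order_trans subsetD)
  fix v
  have "card (nbrs H v) \<le> card (nbrs G v)"
    using assms finite_nbrs[of G v] by (intro card_mono) (auto simp: linear_forest_def nbrs_def)
  also have "\<dots> \<le> 2"
    using G by (simp add: linear_forest_def)
  finally show "card (nbrs H v) \<le> 2" .
qed

text \<open>A second nontrivial component would contribute two further leaves, four in all, so the
  bound 3 already forces a single path.\<close>

lemma linear_forest_path:
  assumes "linear_forest G" "edges G \<noteq> {}" "card (leaves G) \<le> 3"
  obtains vs where "distinct vs" "length vs \<ge> 2" "edges G = walk_edges vs"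
proof -
  from assms have G: "simple_graph G" by (simp add: linear_forest_def)
  obtain vs where vs: "distinct vs" "length vs \<ge> 2" "walk_edges vs \<subseteq> edges G"
    "hd vs \<in> leaves G" "last vs \<in> leaves G"
    "\<And>e. e \<in> edges G \<Longrightarrow> e \<inter> set vs \<noteq> {} \<Longrightarrow> e \<in> walk_edges vs"
    using linear_forest_component[OF assms(1,2)] by metis
  define H where "H = G\<lparr>edges := edges G - walk_edges vs\<rparr>"
  have H: "linear_forest H"
    using linear_forest_subgraph[OF assms(1), of H] by (simp add: H_def)
  have ends: "hd us \<in> set us" "last us \<in> set us" "hd us \<noteq> last us"
    if "distinct us" "length us \<ge> 2" for us :: "nat list"
    using that by (cases us; auto split: if_splits)+
  have "edges H = {}"
  proof (rule ccontr)
    assume "edges H \<noteq> {}"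
    then obtain us where us: "distinct us" "length us \<ge> 2" "walk_edges us \<subseteq> edges H"
      "hd us \<in> leaves H" "last us \<in> leaves H"
      using linear_forest_component[OF H] by metis
    \<comment> \<open>Every edge of \<open>G\<close> that touches \<open>vs\<close> belongs to the
      removed path, so a leaf of \<open>H\<close> is off \<open>vs\<close> and keeps all its
      edges.\<close>
    have out: "v \<notin> set vs \<and> v \<in> leaves G" if "v \<in> leaves H" for v
    proof
      from that obtain u where u: "nbrs H v = {u}"
        by (auto simp: leaves_def card_1_singleton_iff)
      then have "{v, u} \<in> edges G" "{v, u} \<notin> walk_edges vs"
        by (auto simp: nbrs_def H_def)
      with vs(6) show v: "v \<notin> set vs" by blast
      have "nbrs H v = nbrs G v"
        using v walk_edges_subset[of _ vs] by (auto simp: nbrs_def H_def)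
      with that show "v \<in> leaves G" by (simp add: leaves_def)
    qed
    have "{hd vs, last vs, hd us, last us} \<subseteq> leaves G"
      using out us(4,5) vs(4,5) by auto
    moreover have "finite (leaves G)"
      using leaves_subset[OF G] finite_subset by blast
    ultimately have "card {hd vs, last vs, hd us, last us} \<le> 3"
      using assms(3) card_mono by (meson order_trans)
    moreover have "card {hd vs, last vs, hd us, last us} = 4"
    proof -
      have "hd us \<notin> {hd vs, last vs}" "last us \<notin> {hd vs, last vs}"
        using out us(4,5) ends[OF vs(1,2)] by auto
      then show ?thesis using ends[OF vs(1,2)] ends[OF us(1,2)] by auto
    qed
    ultimately show False by simp
  qed
  then have "edges G = walk_edges vs"
    using vs(3) by (auto simp: H_def)
  with vs(1,2) that show ?thesis by blast
qed

section \<open>Matchings and degree sums in linear forests\<close>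

definition matching :: "graph \<Rightarrow> nat set set \<Rightarrow> bool" where
  "matching G X \<longleftrightarrow> X \<subseteq> edges G \<and> pairwise disjnt X"

lemma card_edges_at:
  assumes "simple_graph G"
  shows "card {e \<in> edges G. v \<in> e} = card (nbrs G v)"
proof (rule bij_betw_same_card[symmetric])
  show "bij_betw (\<lambda>u. {v, u}) (nbrs G v) {e \<in> edges G. v \<in> e}"
  proof (rule bij_betw_imageI)
    show "inj_on (\<lambda>u. {v, u}) (nbrs G v)"
      by (auto simp: inj_on_def doubleton_eq_iff)
    show "(\<lambda>u. {v, u}) ` nbrs G v = {e \<in> edges G. v \<in> e}"
    proof (intro equalityI subsetI)
      fix e assume "e \<in> {e \<in> edges G. v \<in> e}"
      then obtain u where "e = {v, u}" "u \<in> nbrs G v"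
        using edge_obtain[OF assms] by blast
      then show "e \<in> (\<lambda>u. {v, u}) ` nbrs G v" by blast
    qed (auto simp: nbrs_def)
  qed
qed

text \<open>Greedy choice: match a leaf v with its only neighbour u and discard all edges at u. At
  most two edges are lost per matching edge, and v has none left.\<close>

lemma linear_forest_matching:
  assumes "linear_forest G"
  shows "\<exists>X. matching G X \<and> card (edges G) \<le> 2 * card X"
  using assms
proof (induction "card (edges G)" arbitrary: G rule: less_induct)
  case less
  then have G: "simple_graph G" and deg: "\<And>v. card (nbrs G v) \<le> 2"
    by (auto simp: linear_forest_def)
  note fin = finite_edges[OF G]
  show ?case
  proof (cases "edges G = {}")
    case True
    then show ?thesis by (intro exI[of _ "{}"]) (simp add: matching_def)
  next
    case False
    obtain v where "v \<in> leaves G"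
      using linear_forest_component[OF less.prems False] by metis
    then obtain u where u: "nbrs G v = {u}"
      by (auto simp: leaves_def card_1_singleton_iff)
    then have vu: "{v, u} \<in> edges G" by (auto simp: nbrs_def)
    define H where "H = G\<lparr>edges := {e \<in> edges G. u \<notin> e}\<rparr>"
    have "nverts H = nverts G" and HG: "edges H \<subseteq> edges G"
      by (auto simp: H_def)
    then have H: "linear_forest H"
      by (rule linear_forest_subgraph[OF less.prems])
    have "{v, u} \<notin> edges H" by (simp add: H_def)
    with HG vu have "edges H \<subset> edges G" by blast
    then have "card (edges H) < card (edges G)"
      using fin by (rule psubset_card_mono[rotated])
    then obtain X where X: "matching H X" "card (edges H) \<le> 2 * card X"
      using less.hyps H by blast
    have Xe: "u \<notin> e \<and> v \<notin> e \<and> e \<in> edges G" if "e \<in> X" for e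
    proof -
      have e: "u \<notin> e" "e \<in> edges G" using that X(1) by (auto simp: matching_def H_def)
      moreover have "v \<notin> e"
        using edge_obtain[OF G e(2), of v] u e(1) by auto
      ultimately show ?thesis by simp
    qed
    have "finite X" using X(1) HG fin by (meson finite_subset matching_def)
    have "edges G = edges H \<union> {e \<in> edges G. u \<in> e}" by (auto simp: H_def)
    then have "card (edges G) \<le> card (edges H) + card {e \<in> edges G. u \<in> e}"
      by (metis card_Un_le)
    also have "\<dots> \<le> 2 * card X + 2"
      using X(2) deg[of u] card_edges_at[OF G, of u] by simp
    also have "\<dots> = 2 * card (insert {v, u} X)"
      using Xe \<open>finite X\<close> by (subst card_insert_disjoint) auto
    finally show ?thesis
      using Xe X(1) vu
      by (intro exI[of _ "insert {v, u} X"]) (auto simp: matching_def pairwise_insert disjnt_def)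
  qed
qed

lemma sum_card_nbrs:
  assumes "simple_graph G"
  shows "(\<Sum>v<nverts G. card (nbrs G v)) = 2 * card (edges G)"
proof -
  have "(\<Sum>v<nverts G. card (nbrs G v)) = (\<Sum>v<nverts G. card {e \<in> edges G. v \<in> e})"
    using card_edges_at[OF assms] by simp
  also have "\<dots> = (\<Sum>e\<in>edges G. card {v \<in> {..<nverts G}. v \<in> e})"
    using finite_edges[OF assms] by (intro sum_card_swap) auto
  also have "\<dots> = (\<Sum>e\<in>edges G. 2)"
  proof (intro sum.cong refl)
    fix e assume "e \<in> edges G"
    then have "e \<subseteq> {..<nverts G}" "card e = 2" using assms by (auto simp: simple_graph_def)
    moreover from this have "{v \<in> {..<nverts G}. v \<in> e} = e" by auto
    ultimately show "card {v \<in> {..<nverts G}. v \<in> e} = 2" by simp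
  qed
  finally show ?thesis by simp
qed

text \<open>Symmetry of the adjacency matrix as a bilinear form.\<close>

lemma sum_nbrs_swap:
  fixes f g :: "nat \<Rightarrow> 'a::comm_semiring_0"
  assumes "simple_graph G"
  shows "(\<Sum>v<nverts G. f v * (\<Sum>u\<in>nbrs G v. g u)) = (\<Sum>u<nverts G. (\<Sum>v\<in>nbrs G u. f v) * g u)"
proof -
  have nb: "{u. u \<in> {..<nverts G} \<and> u \<in> nbrs G v} = nbrs G v"
    "{u. u \<in> {..<nverts G} \<and> v \<in> nbrs G u} = nbrs G v" for v
    using nbrs_subset[OF assms, of v] by (auto simp: nbrs_sym[of v])
  have "(\<Sum>v<nverts G. f v * (\<Sum>u\<in>nbrs G v. g u)) =
      (\<Sum>v<nverts G. \<Sum>u | u \<in> {..<nverts G} \<and> u \<in> nbrs G v. f v * g u)"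
    unfolding nb by (simp add: sum_distrib_left)
  also have "\<dots> = (\<Sum>u<nverts G. \<Sum>v | v \<in> {..<nverts G} \<and> u \<in> nbrs G v. f v * g u)"
    by (rule sum.swap_restrict) auto
  also have "\<dots> = (\<Sum>u<nverts G. \<Sum>v\<in>nbrs G u. f v * g u)"
    unfolding nb ..
  also have "\<dots> = (\<Sum>u<nverts G. (\<Sum>v\<in>nbrs G u. f v) * g u)"
    by (simp add: sum_distrib_right)
  finally show ?thesis .
qed

text \<open>For d in {0, 1, 2} one has d^2 = 2 d, except that d = 1 gives one less.\<close>

lemma linear_forest_degree_squares:
  assumes "linear_forest G"
  shows "(\<Sum>v<nverts G. real (card (nbrs G v)) ^ 2) = 4 * real (card (edges G)) - real (card (leaves G))"
proof -
  have G: "simple_graph G" and deg: "\<And>v. card (nbrs G v) \<le> 2"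
    using assms by (auto simp: linear_forest_def)
  have *: "real (card (nbrs G v)) ^ 2 = 2 * real (card (nbrs G v)) - (if v \<in> leaves G then 1 else 0)" for v
  proof -
    have "card (nbrs G v) = 0 \<or> card (nbrs G v) = 1 \<or> card (nbrs G v) = 2"
      using deg[of v] by linarith
    then show ?thesis by (auto simp: leaves_def)
  qed
  have "(\<Sum>v<nverts G. real (card (nbrs G v)) ^ 2) =
      2 * real (\<Sum>v<nverts G. card (nbrs G v)) - (\<Sum>v<nverts G. if v \<in> leaves G then 1 else 0)"
    unfolding * by (simp add: sum_subtractf sum_distrib_left)
  also have "(\<Sum>v<nverts G. if v \<in> leaves G then 1 else 0 :: real) = real (card ({..<nverts G} \<inter> leaves G))"
    by (simp add: sum.If_cases)
  also have "{..<nverts G} \<inter> leaves G = leaves G"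
    using leaves_subset[OF G] by blast
  finally show ?thesis
    by (simp add: sum_card_nbrs[OF G])
qed

section \<open>Matchings and graphs with a dominating vertex\<close>

lemma copies_K2: "copies k (complete_graph 2) = \<lparr>nverts = 2 * k, edges = {{2 * i, Suc (2 * i)} | i. i < k}\<rparr>"
proof (induction k)
  case (Suc k)
  have K2: "edges (complete_graph 2) = {{0, 1}}"
    unfolding complete_graph_def by (auto simp: less_2_cases_iff)
  have "(\<lambda>e. (\<lambda>v. 2 + v) ` e) ` {{2 * i, Suc (2 * i)} | i. i < k} = {{2 * Suc i, Suc (2 * Suc i)} | i. i < k}"
  proof -
    have "(\<lambda>e. (\<lambda>v. 2 + v) ` e) ` {{2 * i, Suc (2 * i)} | i. i < k} =
        {(\<lambda>v. 2 + v) ` {2 * i, Suc (2 * i)} | i. i < k}" by blast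
    also have "\<dots> = {{2 * Suc i, Suc (2 * Suc i)} | i. i < k}" by simp
    finally show ?thesis .
  qed
  moreover have "{{2 * i, Suc (2 * i)} | i. i < Suc k} =
      insert {0, 1} {{2 * Suc i, Suc (2 * Suc i)} | i. i < k}"
  proof (intro equalityI subsetI)
    fix e assume "e \<in> {{2 * i, Suc (2 * i)} | i. i < Suc k}"
    then obtain i where "e = {2 * i, Suc (2 * i)}" "i < Suc k" by blast
    then show "e \<in> insert {0, 1} {{2 * Suc i, Suc (2 * Suc i)} | i. i < k}"
      by (cases i) auto
  next
    fix e assume "e \<in> insert {0, 1} {{2 * Suc i, Suc (2 * Suc i)} | i. i < k}"
    then consider "e = {2 * 0, Suc (2 * 0)}" | i where "e = {2 * Suc i, Suc (2 * Suc i)}" "i < k"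
      by auto
    then show "e \<in> {{2 * i, Suc (2 * i)} | i. i < Suc k}"
      by cases blast+
  qed
  ultimately show ?case
    using Suc K2 by (simp add: disjoint_union_def complete_graph_def)
qed simp

lemma has_subgraph_copies_K2_imp_matching:
  assumes "has_subgraph G (copies k (complete_graph 2))"
  shows "\<exists>X. matching G X \<and> finite X \<and> card X = k"
proof -
  obtain f where f1: "inj_on f {..<2 * k}"
    and "\<forall>e\<in>{{2 * i, Suc (2 * i)} | i. i < k}. f ` e \<in> edges G"
    using assms unfolding has_subgraph_def copies_K2 graph.select_convs by blast
  then have "f ` {2 * i, Suc (2 * i)} \<in> edges G" if "i < k" for i
    using that by blast
  note f = f1 this
  let ?e = "\<lambda>i. f ` {2 * i, Suc (2 * i)}"
  have d: "?e i \<inter> ?e j = {}" if "i < k" "j < k" "i \<noteq> j" for i j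
  proof -
    have "?e i \<inter> ?e j = f ` ({2 * i, Suc (2 * i)} \<inter> {2 * j, Suc (2 * j)})"
      using that by (intro inj_on_image_Int[OF f(1), symmetric]) auto
    also have "{2 * i, Suc (2 * i)} \<inter> {2 * j, Suc (2 * j)} = {}"
      using that by (auto; presburger)
    finally show ?thesis by simp
  qed
  have "inj_on ?e {..<k}"
  proof (rule inj_onI)
    fix i j assume "i \<in> {..<k}" "j \<in> {..<k}" "?e i = ?e j"
    then show "i = j" using d[of i j] by (cases "i = j") auto
  qed
  then have "card (?e ` {..<k}) = k" by (simp add: card_image)
  moreover have "matching G (?e ` {..<k})"
    unfolding matching_def
  proof (intro conjI pairwiseI)
    fix x y assume "x \<in> ?e ` {..<k}" "y \<in> ?e ` {..<k}" "x \<noteq> y"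
    then obtain i j where "x = ?e i" "y = ?e j" "i < k" "j < k" "i \<noteq> j" by blast
    then show "disjnt x y" using d unfolding disjnt_def by blast
  qed (use f(2) in blast)
  ultimately show ?thesis by blast
qed

lemma matching_imp_has_subgraph_copies_K2:
  assumes G: "simple_graph G" and X: "matching G X" "finite X" "card X = k"
  shows "has_subgraph G (copies k (complete_graph 2))"
proof -
  obtain h where h: "bij_betw h {..<k} X"
    using ex_bij_betw_nat_finite[OF X(2)] X(3) by (auto simp: atLeast0LessThan)
  have "\<exists>a b. e = {a, b} \<and> a \<noteq> b" if "e \<in> X" for e
    using that X(1) G unfolding matching_def simple_graph_def by (metis card_2_iff subsetD)
  then obtain a b where ab: "\<And>e. e \<in> X \<Longrightarrow> e = {a e, b e} \<and> a e \<noteq> b e" by metis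
  have hX: "h i \<in> X" if "i < k" for i using h that by (auto simp: bij_betw_def)
  \<comment> \<open>The labels 2 i and 2 i + 1 of the i-th copy of K_2 go to the two ends of the
    i-th matching edge.\<close>
  define f where "f v = (if even v then a (h (v div 2)) else b (h (v div 2)))" for v :: nat
  have fh: "f v \<in> h (v div 2)" if "v < 2 * k" for v
    using ab[OF hX[of "v div 2"]] that unfolding f_def by (metis insertCI less_mult_imp_div_less mult.commute)
  have fim: "f ` {2 * i, Suc (2 * i)} = h i" if "i < k" for i
  proof -
    have "f ` {2 * i, Suc (2 * i)} = {a (h i), b (h i)}" by (auto simp: f_def)
    also have "\<dots> = h i" by (rule ab[OF hX[OF that], THEN conjunct1, symmetric])
    finally show ?thesis .
  qed
  have "inj_on f {..<2 * k}"
  proof (rule inj_onI)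
    fix v w assume vw: "v \<in> {..<2 * k}" "w \<in> {..<2 * k}" "f v = f w"
    then have lt: "v div 2 < k" "w div 2 < k" by auto
    have "f v \<in> h (v div 2) \<inter> h (w div 2)"
      using fh[of v] fh[of w] vw by auto
    then have "h (v div 2) = h (w div 2)"
      using X(1) hX[OF lt(1)] hX[OF lt(2)] unfolding matching_def pairwise_def disjnt_def by blast
    then have eq: "v div 2 = w div 2"
      using h lt by (auto simp: bij_betw_def inj_on_def)
    moreover have "even v \<longleftrightarrow> even w"
      using vw(3) ab[OF hX[OF lt(1)]] eq by (auto simp: f_def split: if_splits)
    ultimately show "v = w" by (metis div_mod_decomp even_iff_mod_2_eq_zero not_mod_2_eq_0_eq_1)
  qed
  moreover have "f ` {..<2 * k} \<subseteq> {..<nverts G}"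
  proof
    fix u assume "u \<in> f ` {..<2 * k}"
    then obtain v where v: "v < 2 * k" "u = f v" by auto
    then have "u \<in> h (v div 2)" "h (v div 2) \<in> edges G"
      using fh[of v] hX[of "v div 2"] X(1) by (auto simp: matching_def)
    then show "u \<in> {..<nverts G}" using G by (auto simp: simple_graph_def)
  qed
  moreover have "f ` e \<in> edges G" if "e \<in> {{2 * i, Suc (2 * i)} | i. i < k}" for e
    using that fim hX X(1) by (auto simp: matching_def simp del: image_insert)
  ultimately show ?thesis
    unfolding has_subgraph_def copies_K2 by auto
qed

lemma graph_free_copies_K2_iff:
  assumes "simple_graph G"
  shows "graph_free (copies (Suc t) (complete_graph 2)) G \<longleftrightarrow> (\<forall>X. matching G X \<longrightarrow> card X \<le> t)"
proof
  assume free: "graph_free (copies (Suc t) (complete_graph 2)) G"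
  show "\<forall>X. matching G X \<longrightarrow> card X \<le> t"
  proof (intro allI impI, rule ccontr)
    fix X assume X: "matching G X" "\<not> card X \<le> t"
    then have "Suc t \<le> card X" by simp
    then obtain Y where Y: "Y \<subseteq> X" "card Y = Suc t" "finite Y"
      by (rule obtain_subset_with_card_n)
    then have "matching G Y"
      using X(1) by (auto simp: matching_def intro: pairwise_subset)
    then show False
      using matching_imp_has_subgraph_copies_K2[OF assms _ Y(3,2)] free by (simp add: graph_free_def)
  qed
next
  assume "\<forall>X. matching G X \<longrightarrow> card X \<le> t"
  then show "graph_free (copies (Suc t) (complete_graph 2)) G"
    using has_subgraph_copies_K2_imp_matching[of G "Suc t"] unfolding graph_free_def
    by (metis Suc_n_not_le_n)
qed

lemma matching_number_cover:
  assumes G: "simple_graph G" and X: "\<And>X. matching G X \<Longrightarrow> card X \<le> t"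
  obtains S where "finite S" "card S \<le> 2 * t" "\<And>u v. {u, v} \<in> edges G \<Longrightarrow> u \<in> S \<or> v \<in> S"
proof -
  have "matching G {}" by (simp add: matching_def)
  then obtain X where Xm: "matching G X" "\<And>Y. matching G Y \<Longrightarrow> card Y \<le> card X"
    using ex_has_greatest_nat[of "matching G" "{}" card "Suc t"] X by (auto simp: less_Suc_eq_le)
  have fX: "finite X"
    using Xm(1) finite_edges[OF G] finite_subset by (auto simp: matching_def)
  have c2: "card e = 2" if "e \<in> X" for e
    using that Xm(1) G by (auto simp: matching_def simple_graph_def)
  show ?thesis
  proof (rule that[of "\<Union>X"])
    show "finite (\<Union>X)" using fX c2 by (metis card.infinite finite_Union zero_neq_numeral)
    have "card (\<Union>X) \<le> (\<Sum>e\<in>X. card e)" using card_Union_le_sum_card by blast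
    also have "\<dots> = 2 * card X" using c2 by simp
    also have "\<dots> \<le> 2 * t" using X[OF Xm(1)] by simp
    finally show "card (\<Union>X) \<le> 2 * t" .
    fix u v assume uv: "{u, v} \<in> edges G"
    show "u \<in> \<Union>X \<or> v \<in> \<Union>X"
    proof (rule ccontr)
      assume c: "\<not> (u \<in> \<Union>X \<or> v \<in> \<Union>X)"
      then have "matching G (insert {u, v} X)"
        using Xm(1) uv by (auto simp: matching_def pairwise_insert disjnt_def)
      moreover have "{u, v} \<notin> X" using c by auto
      ultimately show False using Xm(2)[of "insert {u, v} X"] fX by simp
    qed
  qed
qed

section \<open>Deleting a dominating vertex\<close>

text \<open>The vertex stays behind as an isolated one, so no relabelling is required; it affects
  neither the degree sums nor the leaves.\<close>

definition delete_vertex :: "graph \<Rightarrow> nat \<Rightarrow> graph" where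
  "delete_vertex G z = G\<lparr>edges := {e \<in> edges G. z \<notin> e}\<rparr>"

lemma delete_vertex_simps [simp]:
  "nverts (delete_vertex G z) = nverts G"
  "edges (delete_vertex G z) = {e \<in> edges G. z \<notin> e}"
  "nbrs (delete_vertex G z) v = (if v = z then {} else nbrs G v - {z})"
  by (auto simp: delete_vertex_def nbrs_def)

definition dominated_by :: "graph \<Rightarrow> nat \<Rightarrow> bool" where
  "dominated_by G z \<longleftrightarrow> simple_graph G \<and> z < nverts G \<and> nbrs G z = {..<nverts G} - {z}"

lemma simple_delete_vertex: "simple_graph G \<Longrightarrow> simple_graph (delete_vertex G z)"
  by (auto simp: simple_graph_def)

text \<open>A cycle would form a wheel with hub z, and the neighbours of v other than z are common
  neighbours of v and z.\<close>

lemma linear_forest_delete_dominating: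
  assumes "outerplanar G" "dominated_by G z"
  shows "linear_forest (delete_vertex G z)"
  unfolding linear_forest_def
proof (intro conjI allI)
  have G: "simple_graph G" and z: "nbrs G z = {..<nverts G} - {z}"
    using assms(2) by (auto simp: dominated_by_def)
  show "simple_graph (delete_vertex G z)"
    using G by (rule simple_delete_vertex)
  show "acyclic_graph (delete_vertex G z)"
    unfolding acyclic_graph_def
  proof (intro allI impI notI)
    fix vs assume vs: "distinct vs" "3 \<le> length vs" "walk_edges vs \<subseteq> edges (delete_vertex G z)"
      "{last vs, hd vs} \<in> edges (delete_vertex G z)"
    have "z \<notin> set vs"
      using Union_walk_edges[of vs] vs(2,3) by auto
    moreover have "set vs \<subseteq> {..<nverts G}"
      using walk_set_subset[of "delete_vertex G z" vs] vs(2,3) simple_delete_vertex[OF G] by simp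
    ultimately have "{z, v} \<in> edges G" if "v \<in> set vs" for v
      using that z by (auto simp: nbrs_def)
    then show False
      using outerplanar_no_wheel[OF assms(1) G vs(1,2), of z] vs(3,4) \<open>z \<notin> set vs\<close> by auto
  qed
  fix v
  show "card (nbrs (delete_vertex G z) v) \<le> 2"
  proof (cases "v = z")
    case False
    have "nbrs G v - {z} \<subseteq> nbrs G z \<inter> nbrs G v"
      using z nbrs_subset[OF G, of v] by auto
    then have "card (nbrs G v - {z}) \<le> card (nbrs G z \<inter> nbrs G v)"
      using finite_nbrs[OF G] by (intro card_mono) auto
    also have "\<dots> \<le> 2"
      using False by (intro outerplanar_common_nbrs[OF assms(1) G]) simp
    finally show ?thesis using False by simp
  qed simp
qed

text \<open>The matching and z together cover at most 2 t + 1 vertices, so some vertex w stays free,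
  and the edge zw enlarges the matching.\<close>

lemma matching_delete_dominating:
  assumes z: "dominated_by G z" and X: "matching (delete_vertex G z) X"
    and bound: "\<And>X. matching G X \<Longrightarrow> card X \<le> t" and n: "2 * t + 1 < nverts G"
  shows "card X < t"
proof -
  have G: "simple_graph G" using z by (simp add: dominated_by_def)
  have XG: "matching G X" and Xz: "\<And>e. e \<in> X \<Longrightarrow> z \<notin> e"
    using X by (auto simp: matching_def)
  have fX: "finite X"
    using XG finite_edges[OF G] finite_subset by (auto simp: matching_def)
  have "card (\<Union>X) \<le> (\<Sum>e\<in>X. card e)" using card_Union_le_sum_card by blast
  also have "\<dots> = 2 * card X"
    using XG G by (subst sum.cong[of X X card "\<lambda>_. 2"]) (auto simp: matching_def simple_graph_def)
  also have "\<dots> \<le> 2 * t" using bound[OF XG] by simp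
  finally have "card (insert z (\<Union>X)) \<le> 2 * t + 1"
    by (rule order_trans[OF card_insert_le_m1[of "2 * t + 1", simplified]]) auto
  moreover have "insert z (\<Union>X) \<subseteq> {..<nverts G}"
    using XG G z by (auto simp: matching_def simple_graph_def dominated_by_def)
  ultimately have "insert z (\<Union>X) \<noteq> {..<nverts G}"
    using n by auto
  then obtain w where w: "w < nverts G" "w \<noteq> z" "w \<notin> \<Union>X"
    using \<open>insert z (\<Union>X) \<subseteq> {..<nverts G}\<close> by auto
  then have "{z, w} \<in> edges G"
    using z by (auto simp: dominated_by_def nbrs_def)
  then have "matching G (insert {z, w} X)"
    using XG Xz w by (auto simp: matching_def pairwise_insert disjnt_def)
  moreover have "{z, w} \<notin> X" using Xz by auto
  ultimately show ?thesis
    using bound[of "insert {z, w} X"] fX by simp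
qed

lemma card_edges_delete_dominating:
  assumes "outerplanar G" "dominated_by G z"
    and bound: "\<And>X. matching G X \<Longrightarrow> card X \<le> t" and n: "2 * t + 1 < nverts G"
  shows "card (edges (delete_vertex G z)) \<le> 2 * (t - 1)"
proof -
  obtain X where X: "matching (delete_vertex G z) X" "card (edges (delete_vertex G z)) \<le> 2 * card X"
    using linear_forest_matching[OF linear_forest_delete_dominating[OF assms(1,2)]] by blast
  moreover have "card X < t"
    by (rule matching_delete_dominating[OF assms(2) X(1) bound n])
  ultimately show ?thesis by linarith
qed

section \<open>The fan as candidate\<close>

lemma dominated_by_fan_graph: "k < n \<Longrightarrow> dominated_by (fan_graph n k) 0"
  using simple_fan_graph[of k n]
  by (auto simp: dominated_by_def nbrs_def fan_graph_def doubleton_eq_iff)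

lemma delete_hub_edges: "{e \<in> edges (fan_graph n k). 0 \<notin> e} = (\<lambda>j. {j, Suc j}) ` {1..<k}"
  by (auto simp: fan_graph_def)

lemma card_delete_hub_edges: "card {e \<in> edges (fan_graph n k). 0 \<notin> e} = k - 1"
proof -
  have "inj_on (\<lambda>j. {j, Suc j}) {1..<k}"
    by (auto simp: inj_on_def doubleton_eq_iff)
  then show ?thesis by (simp add: delete_hub_edges card_image)
qed

text \<open>Only an inclusion, as there are no leaves for k = 1; few leaves mean a large sum of
  squared degrees, so an upper bound is the useful direction.\<close>

lemma leaves_delete_hub:
  assumes "k < n"
  shows "leaves (delete_vertex (fan_graph n k) 0) \<subseteq> {1, k}"
proof
  let ?H = "delete_vertex (fan_graph n k) 0"
  have H: "simple_graph ?H" using simple_fan_graph[OF assms] by (rule simple_delete_vertex)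
  fix v assume "v \<in> leaves ?H"
  then have c: "card (nbrs ?H v) = 1" by (simp add: leaves_def)
  then obtain u where "u \<in> nbrs ?H v" by (auto simp: card_1_singleton_iff)
  then have "{v, u} \<in> (\<lambda>j. {j, Suc j}) ` {1..<k}"
    unfolding delete_hub_edges[of n, symmetric] by (auto simp: nbrs_def split: if_splits)
  then have v: "1 \<le> v" "v \<le> k" by (auto simp: doubleton_eq_iff)
  show "v \<in> {1, k}"
  proof (rule ccontr)
    assume "v \<notin> {1, k}"
    with v have v': "1 < v" "v < k" by auto
    then have "v - 1 \<in> {1..<k}" "v \<in> {1..<k}" by auto
    then have "{v - 1, Suc (v - 1)} \<in> (\<lambda>j. {j, Suc j}) ` {1..<k}" "{v, Suc v} \<in> (\<lambda>j. {j, Suc j}) ` {1..<k}"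
      by blast+
    then have "{v - 1, Suc v} \<subseteq> nbrs ?H v"
      using v' unfolding delete_hub_edges[of n, symmetric] by (auto simp: nbrs_def insert_commute)
    then have "card {v - 1, Suc v} \<le> card (nbrs ?H v)"
      by (intro card_mono finite_nbrs[OF H])
    with c v' show False by simp
  qed
qed

text \<open>The hub 0 and the even path vertices 2, ..., 2 t - 2 form a vertex cover of size t, and
  disjoint edges pick distinct members of it.\<close>

lemma fan_graph_matching:
  assumes "t \<ge> 1" "matching (fan_graph n (2 * t - 1)) X"
  shows "card X \<le> t"
proof -
  let ?C = "(\<lambda>i. 2 * i) ` {..<t}"
  have "\<exists>c. c \<in> e \<inter> ?C" if "e \<in> edges (fan_graph n (2 * t - 1))" for e
    using that
  proof (cases rule: fan_graph_edge_cases)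
    case (spoke j)
    with assms(1) have "0 \<in> e \<inter> ?C" by force
    then show ?thesis by blast
  next
    case (rim j)
    show ?thesis
    proof (cases "even j")
      case True
      then obtain i where "j = 2 * i" by blast
      with rim have "j \<in> e \<inter> ?C" by auto
      then show ?thesis by blast
    next
      case False
      then obtain i where "j = 2 * i + 1" using oddE by blast
      with rim have "Suc j = 2 * Suc i" "Suc i < t" by auto
      with rim have "Suc j \<in> e \<inter> ?C" by (metis IntI image_eqI insertCI lessThan_iff)
      then show ?thesis by blast
    qed
  qed
  then obtain c where c: "\<And>e. e \<in> edges (fan_graph n (2 * t - 1)) \<Longrightarrow> c e \<in> e \<inter> ?C" by metis
  have X: "X \<subseteq> edges (fan_graph n (2 * t - 1))" "pairwise disjnt X"
    using assms(2) by (auto simp: matching_def)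
  have "inj_on c X"
  proof (rule inj_onI)
    fix e e' assume "e \<in> X" "e' \<in> X" "c e = c e'"
    then have "c e \<in> e \<inter> e'" using c X(1) by (metis IntD1 IntI subsetD)
    with \<open>e \<in> X\<close> \<open>e' \<in> X\<close> show "e = e'"
      using X(2) by (auto simp: pairwise_def disjnt_def)
  qed
  moreover have "c ` X \<subseteq> ?C" using c X(1) by blast
  ultimately have "card X \<le> card ?C" by (intro card_inj_on_le) auto
  also have "\<dots> \<le> t" using card_image_le[of "{..<t}" "\<lambda>i. 2 * i"] by simp
  finally show ?thesis .
qed

lemma dominated_path_iso_fan_graph:
  assumes z: "dominated_by G z"
    and vs: "distinct vs" "set vs \<subseteq> {..<nverts G} - {z}" "edges (delete_vertex G z) = walk_edges vs"
  shows "graph_iso G (fan_graph (nverts G) (length vs))"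
proof -
  let ?n = "nverts G"
  obtain ws where ws: "set ws = {..<?n} - {z} - set vs" "distinct ws"
    using finite_distinct_list[of "{..<?n} - {z} - set vs"] by auto
  \<comment> \<open>The isomorphism sends each vertex to its position in this list: hub, path,
    remaining vertices.\<close>
  define L where "L = z # vs @ ws"
  have L: "distinct L" "set L = {..<?n}"
    using vs ws z by (auto simp: L_def dominated_by_def)
  have len: "length L = ?n"
    using distinct_card[OF L(1)] L(2) by simp
  have bij: "bij_betw ((!) L) {..<?n} {..<?n}"
    by (rule bij_betw_nth[OF L(1)]) (simp_all only: L(2) len)
  define f where "f = inv_into {..<?n} ((!) L)"
  have f: "f (L ! i) = i" if "i < ?n" for i
    using bij that by (simp add: f_def bij_betw_def)
  have pair: "{L ! i, L ! j} = {L ! p, L ! q} \<longleftrightarrow> {i, j} = {p, q}"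
    if "i < ?n" "j < ?n" "p < ?n" "q < ?n" for i j p q
    using that L(1) len by (auto simp: doubleton_eq_iff nth_eq_iff_index_eq)
  have hub: "{z, L ! j} \<in> edges G \<longleftrightarrow> {0, j} \<in> edges (fan_graph ?n (length vs))" if "j < ?n" for j
  proof -
    have "{z, L ! j} \<in> edges G \<longleftrightarrow> L ! j \<in> nbrs G z" by (simp add: nbrs_def)
    also have "\<dots> \<longleftrightarrow> L ! j \<noteq> L ! 0"
      using z that L(2) len nth_mem[of j L] by (auto simp: dominated_by_def L_def)
    also have "\<dots> \<longleftrightarrow> j \<noteq> 0"
      using that L(1) len by (subst nth_eq_iff_index_eq) auto
    also have "\<dots> \<longleftrightarrow> {0, j} \<in> edges (fan_graph ?n (length vs))"
      using that by (auto simp: fan_graph_def doubleton_eq_iff)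
    finally show ?thesis .
  qed
  have len_vs: "length vs < ?n" using len by (simp add: L_def)
  have adj: "{L ! i, L ! j} \<in> edges G \<longleftrightarrow> {i, j} \<in> edges (fan_graph ?n (length vs))"
    if ij: "i < ?n" "j < ?n" for i j
  proof -
    consider "i = 0" | "j = 0" | "i > 0" "j > 0" by blast
    then show ?thesis
    proof cases
      case 1
      with hub[OF ij(2)] show ?thesis by (simp add: L_def)
    next
      case 2
      with hub[OF ij(1)] show ?thesis by (simp add: L_def insert_commute)
    next
      case 3
      then have "L ! i \<noteq> z" "L ! j \<noteq> z"
        using L(1) ij len nth_eq_iff_index_eq[of L i 0] nth_eq_iff_index_eq[of L j 0]
        by (auto simp: L_def)
      then have "{L ! i, L ! j} \<in> edges G \<longleftrightarrow> {L ! i, L ! j} \<in> walk_edges vs"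
        unfolding vs(3)[symmetric] by simp
      \<comment> \<open>Position 0 of \<open>L\<close> is the hub, so index a in \<open>vs\<close>
        becomes a + 1 in \<open>L\<close>.\<close>
      also have "\<dots> \<longleftrightarrow> (\<exists>a. Suc a < length vs \<and> {L ! i, L ! j} = {L ! Suc a, L ! Suc (Suc a)})"
        unfolding walk_edges_nth by (auto simp: L_def nth_append)
      also have "\<dots> \<longleftrightarrow> (\<exists>a. Suc a < length vs \<and> {i, j} = {Suc a, Suc (Suc a)})"
        using ij len_vs by (intro ex_cong1 conj_cong refl pair) auto
      also have "\<dots> \<longleftrightarrow> {i, j} \<in> edges (fan_graph ?n (length vs))"
      proof -
        have "{i, j} \<notin> {{0, j} | j. 1 \<le> j \<and> j < ?n}"
          using 3 by (auto simp: doubleton_eq_iff)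
        moreover have "(\<exists>b. {i, j} = {b, Suc b} \<and> 1 \<le> b \<and> b < length vs) \<longleftrightarrow>
            (\<exists>a. Suc a < length vs \<and> {i, j} = {Suc a, Suc (Suc a)})"
          by (metis Suc_le_D Suc_le_mono One_nat_def le0)
        ultimately show ?thesis
          unfolding fan_graph_def graph.select_convs Un_iff mem_Collect_eq by argo
      qed
      finally show ?thesis .
    qed
  qed
  show ?thesis
    unfolding graph_iso_def
  proof (intro exI conjI allI impI)
    show "bij_betw f {..<nverts G} {..<nverts (fan_graph ?n (length vs))}"
      using bij_betw_inv_into[OF bij] by (simp add: f_def)
    fix u v assume "u < nverts G" "v < nverts G"
    then obtain i j where "i < ?n" "u = L ! i" "j < ?n" "v = L ! j"
      using L(2) len by (metis in_set_conv_nth lessThan_iff)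
    then show "{u, v} \<in> edges G \<longleftrightarrow> {f u, f v} \<in> edges (fan_graph ?n (length vs))"
      using adj f by simp
  qed
qed

lemma spokes_eq: "{{i, 1 + j} | i j. i < 1 \<and> j < n - 1} = {{0, j} | j. 1 \<le> j \<and> j < (n::nat)}"
proof (intro equalityI subsetI)
  fix e assume "e \<in> {{0, j} | j. 1 \<le> j \<and> j < n}"
  then obtain j where "e = {0, j}" "1 \<le> j" "j < n" by blast
  then have "e = {0, 1 + (j - 1)} \<and> (0::nat) < 1 \<and> j - 1 < n - 1" by auto
  then show "e \<in> {{i, 1 + j} | i j. i < 1 \<and> j < n - 1}" by blast
qed auto

lemma complete_bipartite_eq_fan_graph:
  assumes "n \<ge> 1"
  shows "complete_bipartite 1 (n - 1) = fan_graph n 1"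
proof -
  show ?thesis
    unfolding complete_bipartite_def fan_graph_def spokes_eq using assms by simp
qed

lemma copies_K1: "copies m (path_graph 1) = \<lparr>nverts = m, edges = {}\<rparr>"
  by (induction m) (simp_all add: disjoint_union_def path_graph_def)

text \<open>The chosen labels make this an equality and not only an isomorphism. As 1 divides every
  number, \<open>H_OP\<close> is in its first case.\<close>

lemma join_eq_fan_graph:
  assumes "1 \<le> k" "k < n"
  shows "graph_join (complete_graph 1) (H_OP n k 1) = fan_graph n k"
proof -
  have H: "H_OP n k 1 = \<lparr>nverts = n - 1, edges = {{i, Suc i} | i. Suc i < k}\<rparr>"
    unfolding H_OP_def copies_K1 using assms by (simp add: disjoint_union_def path_graph_def)
  have K1: "complete_graph 1 = \<lparr>nverts = 1, edges = {}\<rparr>"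
    by (simp add: complete_graph_def)
  have rim: "(\<lambda>e. (\<lambda>v. 1 + v) ` e) ` {{i, Suc i} | i. Suc i < k} = {{j, Suc j} | j. 1 \<le> j \<and> j < k}"
  proof (intro equalityI subsetI)
    fix e assume "e \<in> {{j, Suc j} | j. 1 \<le> j \<and> j < k}"
    then obtain j where j: "e = {j, Suc j}" "1 \<le> j" "j < k" by blast
    then have "e = (\<lambda>v. 1 + v) ` {j - 1, Suc (j - 1)}" by auto
    moreover have "{j - 1, Suc (j - 1)} \<in> {{i, Suc i} | i. Suc i < k}" using j by auto
    ultimately show "e \<in> (\<lambda>e. (\<lambda>v. 1 + v) ` e) ` {{i, Suc i} | i. Suc i < k}" by blast
  qed auto
  show ?thesis
    unfolding H K1 graph_join_def disjoint_union_def fan_graph_def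
    using assms rim spokes_eq[of n] by (simp add: Un_commute)
qed

section \<open>Spectral radius of a graph with a dominating vertex\<close>

text \<open>The number of walks of length two, sorted by their middle vertex.\<close>

definition degree_square_sum :: "graph \<Rightarrow> real" where
  "degree_square_sum G = (\<Sum>v<nverts G. real (card (nbrs G v)) ^ 2)"

lemma degree_square_sum_nonneg: "0 \<le> degree_square_sum G"
  by (simp add: degree_square_sum_def sum_nonneg)

lemma sum_real_card_nbrs:
  "simple_graph G \<Longrightarrow> (\<Sum>v<nverts G. real (card (nbrs G v))) = 2 * real (card (edges G))"
  using arg_cong[OF sum_card_nbrs, of G real] by simp

lemma sum_nbr_degrees:
  assumes "simple_graph G"
  shows "(\<Sum>v<nverts G. \<Sum>u\<in>nbrs G v. real (card (nbrs G u))) = degree_square_sum G"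
  using sum_nbrs_swap[OF assms, of "\<lambda>_. 1::real" "\<lambda>u. real (card (nbrs G u))"]
  by (simp add: degree_square_sum_def power2_eq_square)

text \<open>Iterating the eigenvalue inequality three times away from the dominating vertex counts walks
  of length 0, 1 and 2 in the rest of the graph; the remainder is controlled because entries outside
  the dominating vertex are at most \<open>1 / (\<rho> - 2)\<close>.\<close>

lemma dominated_spectral_upper:
  fixes G :: graph
  defines "\<rho> \<equiv> graph_spectral_radius G"
  assumes dom: "dominated_by G z" and forest: "linear_forest (delete_vertex G z)"
    and n: "nverts G > 1" and rho: "\<rho> > 2"
  shows "\<rho> ^ 3 \<le> (real (nverts G) - 1) * \<rho> + 2 * real (card (edges (delete_vertex G z)))
    + degree_square_sum (delete_vertex G z) / (\<rho> - 2)"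
proof -
  define H where "H = delete_vertex G z"
  define V where "V = {..<nverts G}"
  have G: "simple_graph G" and z: "z \<in> V" "nbrs G z = V - {z}"
    using dom by (auto simp: dominated_by_def V_def)
  have H: "simple_graph H" "nverts H = nverts G" and deg: "\<And>v. card (nbrs H v) \<le> 2"
    using forest by (auto simp: linear_forest_def H_def)
  have Hz: "nbrs H z = {}" and HG: "\<And>v. nbrs H v \<subseteq> V - {z}"
    using nbrs_subset[OF G] by (auto simp: H_def V_def)
  have fV: "finite V" by (simp add: V_def)
  obtain x where x: "\<And>i. (0::real) \<le> x i" "\<exists>i<nverts G. x i > 0"
    "\<And>i. i < nverts G \<Longrightarrow> \<rho> * x i \<le> (\<Sum>j\<in>nbrs G i. x j)"
    using spectral_radius_subharmonic[OF G] n unfolding \<rho>_def by (metis gr0I not_one_less_zero)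
  have step: "\<rho> * x v \<le> x z + (\<Sum>u\<in>nbrs H v. x u)" if "v \<in> V - {z}" for v
  proof -
    have zv: "z \<in> nbrs G v" using that z by (simp add: nbrs_sym)
    have "\<rho> * x v \<le> (\<Sum>u\<in>nbrs G v. x u)"
      using that x(3) by (simp add: V_def)
    also have "\<dots> = x z + (\<Sum>u\<in>nbrs G v - {z}. x u)"
      by (rule sum.remove[OF finite_nbrs[OF G] zv])
    finally show ?thesis using that by (simp add: H_def)
  qed
  have ne: "V - {z} \<noteq> {}"
  proof
    assume "V - {z} = {}"
    then have "card V \<le> card {z}" by (intro card_mono) auto
    with n show False by (simp add: V_def)
  qed
  \<comment> \<open>At the largest entry off z, at most two neighbours remain besides z, so \<rho> x
    v <= x z + 2 x v.\<close>
  have small: "x u \<le> x z / (\<rho> - 2)" if "u \<in> V - {z}" for u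
  proof -
    have "Max (x ` (V - {z})) \<in> x ` (V - {z})"
      using fV ne by (intro Max_in) auto
    then obtain v where v: "Max (x ` (V - {z})) = x v" "v \<in> V - {z}" by (rule imageE)
    have le: "x w \<le> x v" if "w \<in> V - {z}" for w
      unfolding v(1)[symmetric] using that fV by (intro Max_ge) auto
    have "(\<Sum>w\<in>nbrs H v. x w) \<le> real (card (nbrs H v)) * x v"
      using HG le by (intro sum_bounded_above) blast
    also have "\<dots> \<le> 2 * x v"
      using deg[of v] x(1) by (intro mult_right_mono) auto
    finally have "(\<rho> - 2) * x v \<le> x z"
      using step[OF v(2)] by (simp add: algebra_simps)
    then have "x v \<le> x z / (\<rho> - 2)"
      using rho by (simp add: pos_le_divide_eq mult.commute)
    with le[OF that] show ?thesis by linarith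
  qed
  have xz: "x z > 0"
  proof (rule ccontr)
    assume "\<not> x z > 0"
    then have "x z = 0" using x(1)[of z] by simp
    then have "x u \<le> 0" if "u \<in> V" for u
      using small[of u] that by (cases "u = z") auto
    with x(2) show False by (force simp: V_def)
  qed
  define y where "y v = x v / x z" for v
  have y0: "0 \<le> y v" for v using x(1) xz by (simp add: y_def)
  have ysmall: "y u \<le> 1 / (\<rho> - 2)" if "u \<in> V - {z}" for u
    using divide_right_mono[OF small[OF that], of "x z"] xz by (simp add: y_def)
  have ystep: "\<rho> * y v \<le> 1 + (\<Sum>u\<in>nbrs H v. y u)" if "v \<in> V - {z}" for v
    using divide_right_mono[OF step[OF that], of "x z"] xz
    by (simp add: y_def sum_divide_distrib add_divide_distrib)
  define c where "c v = real (card (nbrs H v))" for v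
  have cz: "c z = 0" by (simp add: c_def Hz)
  have "\<rho> * x z / x z \<le> (\<Sum>j\<in>V - {z}. x j) / x z"
    using x(3)[of z] z xz by (intro divide_right_mono) (auto simp: V_def)
  then have hub: "\<rho> \<le> (\<Sum>v\<in>V - {z}. y v)"
    using xz by (simp add: y_def sum_divide_distrib)
  \<comment> \<open>With A the adjacency matrix of \<open>H\<close>, these are the inner products of
    y with A 1 and A^2 1; \<open>sum_nbrs_swap\<close> moves A from y to the constant
    vector.\<close>
  let ?T1 = "\<Sum>u\<in>V. c u * y u" and ?T2 = "\<Sum>w\<in>V. (\<Sum>u\<in>nbrs H w. c u) * y w"
  have "\<rho> * \<rho> \<le> \<rho> * (\<Sum>v\<in>V - {z}. y v)"
    using hub rho by (intro mult_left_mono) auto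
  also have "\<dots> \<le> (\<Sum>v\<in>V - {z}. 1 + (\<Sum>u\<in>nbrs H v. y u))"
    unfolding sum_distrib_left using ystep by (rule sum_mono)
  also have "\<dots> = (real (nverts G) - 1) + (\<Sum>v\<in>V. \<Sum>u\<in>nbrs H v. y u)"
  proof -
    have "(\<Sum>v\<in>V. \<Sum>u\<in>nbrs H v. y u) = (\<Sum>v\<in>V - {z}. \<Sum>u\<in>nbrs H v. y u)"
      using sum.remove[OF fV z(1), of "\<lambda>v. \<Sum>u\<in>nbrs H v. y u"] by (simp add: Hz)
    moreover have "real (card (V - {z})) = real (nverts G) - 1"
      using z(1) n by (simp add: V_def of_nat_diff)
    ultimately show ?thesis by (simp add: sum.distrib)
  qed
  also have "(\<Sum>v\<in>V. \<Sum>u\<in>nbrs H v. y u) = ?T1"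
    using sum_nbrs_swap[OF H(1), of "\<lambda>_. 1" y] by (simp add: V_def H(2) c_def)
  finally have 1: "\<rho> * \<rho> \<le> (real (nverts G) - 1) + ?T1" .
  have "\<rho> * ?T1 = (\<Sum>u\<in>V. c u * (\<rho> * y u))"
    by (simp add: sum_distrib_left mult_ac)
  also have "\<dots> \<le> (\<Sum>u\<in>V. c u * (1 + (\<Sum>w\<in>nbrs H u. y w)))"
  proof (intro sum_mono)
    fix u assume "u \<in> V"
    then show "c u * (\<rho> * y u) \<le> c u * (1 + (\<Sum>w\<in>nbrs H u. y w))"
      using ystep[of u] cz by (cases "u = z") (auto intro!: mult_left_mono simp: c_def)
  qed
  also have "\<dots> = (\<Sum>u\<in>V. c u) + (\<Sum>u\<in>V. c u * (\<Sum>w\<in>nbrs H u. y w))"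
    by (simp add: distrib_left sum.distrib)
  also have "(\<Sum>u\<in>V. c u) = 2 * real (card (edges H))"
    using sum_real_card_nbrs[OF H(1)] by (simp add: c_def V_def H(2))
  also have "(\<Sum>u\<in>V. c u * (\<Sum>w\<in>nbrs H u. y w)) = ?T2"
    using sum_nbrs_swap[OF H(1), of c y] by (simp add: V_def H(2))
  finally have 2: "\<rho> * ?T1 \<le> 2 * real (card (edges H)) + ?T2" .
  have "?T2 \<le> (\<Sum>w\<in>V. (\<Sum>u\<in>nbrs H w. c u) * (1 / (\<rho> - 2)))"
  proof (intro sum_mono)
    fix w assume w: "w \<in> V"
    show "(\<Sum>u\<in>nbrs H w. c u) * y w \<le> (\<Sum>u\<in>nbrs H w. c u) * (1 / (\<rho> - 2))"
    proof (cases "w = z")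
      case False
      with w show ?thesis
        by (intro mult_left_mono ysmall sum_nonneg) (auto simp: c_def)
    qed (simp add: Hz)
  qed
  also have "\<dots> = degree_square_sum H / (\<rho> - 2)"
    using sum_nbr_degrees[OF H(1)]
    by (simp add: sum_divide_distrib[symmetric] c_def V_def H(2))
  finally have 3: "?T2 \<le> degree_square_sum H / (\<rho> - 2)" .
  have "\<rho> ^ 3 = \<rho> * (\<rho> * \<rho>)" by (simp add: power3_eq_cube)
  also have "\<dots> \<le> \<rho> * ((real (nverts G) - 1) + ?T1)"
    using 1 rho by (intro mult_left_mono) auto
  also have "\<dots> = (real (nverts G) - 1) * \<rho> + \<rho> * ?T1"
    by (simp add: algebra_simps)
  finally show ?thesis
    using 2 3 unfolding H_def by linarith
qed

text \<open>With entry 1 at z, the eigenvalue equation off z asks for (\<mu> - A)^{-1} 1, where A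
  belongs to the graph without z. The certificate uses the first three terms of the series, 1 /
  \<mu> + A 1 / \<mu>^2 + A^2 1 / \<mu>^3. Truncation only helps off z, and \<open>le\<close> is the
  inequality at z times \<mu>^3.\<close>

lemma dominated_spectral_lower:
  assumes dom: "dominated_by G z" and mu: "\<mu> > 0"
    and le: "\<mu> ^ 4 \<le> (real (nverts G) - 1) * \<mu>\<^sup>2 + 2 * real (card (edges (delete_vertex G z))) * \<mu>
      + degree_square_sum (delete_vertex G z)"
  shows "\<mu> \<le> graph_spectral_radius G"
proof -
  define H where "H = delete_vertex G z"
  define V where "V = {..<nverts G}"
  have G: "simple_graph G" and z: "z \<in> V" "nbrs G z = V - {z}"
    using dom by (auto simp: dominated_by_def V_def)
  have H: "simple_graph H" "nverts H = nverts G"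
    using simple_delete_vertex[OF G] by (auto simp: H_def)
  have Hz: "nbrs H z = {}" and HG: "\<And>v. nbrs H v \<subseteq> V - {z}"
    using nbrs_subset[OF G] by (auto simp: H_def V_def)
  have fV: "finite V" by (simp add: V_def)
  define c where "c v = real (card (nbrs H v))" for v
  define d where "d v = (\<Sum>u\<in>nbrs H v. c u)" for v
  define b where "b v = 1 / \<mu> + c v / \<mu>\<^sup>2 + d v / \<mu> ^ 3" for v
  define y where "y v = (if v = z then 1 else b v)" for v
  have d0: "0 \<le> d v" for v by (simp add: d_def c_def sum_nonneg)
  have b0: "0 \<le> b v" for v using mu d0 by (simp add: b_def c_def)
  show ?thesis
  proof (rule spectral_radius_ge_superharmonic[OF G, of y z])
    fix v assume v: "v < nverts G"
    show "\<mu> * y v \<le> (\<Sum>u\<in>nbrs G v. y u)"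
    proof (cases "v = z")
      case True
      have "(\<Sum>v\<in>V. b v) = real (nverts G) / \<mu> + (\<Sum>v\<in>V. c v) / \<mu>\<^sup>2 + (\<Sum>v\<in>V. d v) / \<mu> ^ 3"
        by (simp add: b_def sum.distrib sum_divide_distrib V_def)
      also have "(\<Sum>v\<in>V. c v) = 2 * real (card (edges H))"
        using sum_real_card_nbrs[OF H(1)] by (simp add: c_def V_def H(2))
      also have "(\<Sum>v\<in>V. d v) = degree_square_sum H"
        using sum_nbr_degrees[OF H(1)] by (simp add: c_def d_def V_def H(2))
      finally have s: "(\<Sum>v\<in>V - {z}. b v) = (real (nverts G) - 1) / \<mu> + 2 * real (card (edges H)) / \<mu>\<^sup>2
          + degree_square_sum H / \<mu> ^ 3"
        using sum.remove[OF fV z(1), of b] by (simp add: b_def c_def d_def Hz diff_divide_distrib)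
      have "\<mu> * \<mu> ^ 3 \<le> (\<Sum>v\<in>V - {z}. b v) * \<mu> ^ 3"
      proof -
        have "(\<Sum>v\<in>V - {z}. b v) * \<mu> ^ 3 = (real (nverts G) - 1) * \<mu>\<^sup>2
            + 2 * real (card (edges H)) * \<mu> + degree_square_sum H"
          unfolding s using mu by (simp add: field_simps power2_eq_square power3_eq_cube)
        then show ?thesis
          using le by (simp add: H_def power4_eq_xxxx power3_eq_cube mult.assoc)
      qed
      then have "\<mu> \<le> (\<Sum>v\<in>V - {z}. b v)"
        using mu mult_le_cancel_right_pos[of "\<mu> ^ 3" \<mu>] by simp
      also have "\<dots> = (\<Sum>v\<in>V - {z}. y v)"
        by (intro sum.cong) (auto simp: y_def)
      finally show ?thesis using True z by (simp add: y_def)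
    next
      case False
      with v have zv: "z \<in> nbrs G v" using z by (simp add: nbrs_sym V_def)
      have nb: "nbrs G v - {z} = nbrs H v" using False by (simp add: H_def)
      have "\<mu> * y v = 1 + c v / \<mu> + d v / \<mu>\<^sup>2"
        using False mu by (simp add: y_def b_def field_simps power2_eq_square power3_eq_cube)
      also have "\<dots> = 1 + (\<Sum>u\<in>nbrs H v. 1 / \<mu> + c u / \<mu>\<^sup>2)"
        by (simp add: sum.distrib sum_divide_distrib c_def d_def)
      also have "(\<Sum>u\<in>nbrs H v. 1 / \<mu> + c u / \<mu>\<^sup>2) \<le> (\<Sum>u\<in>nbrs H v. y u)"
      proof (intro sum_mono)
        fix u assume "u \<in> nbrs H v"
        then have "u \<noteq> z" using HG by blast
        then show "1 / \<mu> + c u / \<mu>\<^sup>2 \<le> y u" using d0 mu by (simp add: y_def b_def)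
      qed
      also have "1 + (\<Sum>u\<in>nbrs H v. y u) = (\<Sum>u\<in>nbrs G v. y u)"
        using sum.remove[OF finite_nbrs[OF G] zv, of y] nb by (simp add: y_def)
      finally show ?thesis by simp
    qed
  qed (use z b0 in \<open>auto simp: y_def V_def\<close>)
qed

lemma dominated_spectral_radius_square:
  assumes "dominated_by G z" "nverts G > 1"
  shows "sqrt (real (nverts G) - 1) \<le> graph_spectral_radius G"
proof (rule dominated_spectral_lower[OF assms(1)])
  have sq: "(sqrt (real (nverts G) - 1))\<^sup>2 = real (nverts G) - 1"
    using assms(2) by simp
  have "sqrt (real (nverts G) - 1) ^ 4 = (sqrt (real (nverts G) - 1))\<^sup>2 * (sqrt (real (nverts G) - 1))\<^sup>2"
    by (simp only: power4_eq_xxxx power2_eq_square mult.assoc)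
  also have "\<dots> = (real (nverts G) - 1) * (sqrt (real (nverts G) - 1))\<^sup>2"
    by (simp only: sq)
  finally show "sqrt (real (nverts G) - 1) ^ 4 \<le> (real (nverts G) - 1) * (sqrt (real (nverts G) - 1))\<^sup>2
      + 2 * real (card (edges (delete_vertex G z))) * sqrt (real (nverts G) - 1)
      + degree_square_sum (delete_vertex G z)"
    using assms(2) degree_square_sum_nonneg by simp
qed (use assms in simp)

text \<open>If the polynomial inequality failed at \<mu>, then by continuity it would fail at some x
  > \<mu> too, and x would be a lower bound for the spectral radius.\<close>

lemma dominated_spectral_root:
  assumes dom: "dominated_by G z" and mu: "\<mu> > 0" "graph_spectral_radius G \<le> \<mu>"
  shows "(real (nverts G) - 1) * \<mu>\<^sup>2 + 2 * real (card (edges (delete_vertex G z))) * \<mu>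
      + degree_square_sum (delete_vertex G z) \<le> \<mu> ^ 4"
proof (rule ccontr)
  let ?p = "\<lambda>x. (real (nverts G) - 1) * x\<^sup>2 + 2 * real (card (edges (delete_vertex G z))) * x
      + degree_square_sum (delete_vertex G z) - x ^ 4"
  assume "\<not> ?thesis"
  then have "?p \<mu> > 0" by simp
  moreover have "(?p \<longlongrightarrow> ?p \<mu>) (at_right \<mu>)"
    by (intro tendsto_intros)
  ultimately have "eventually (\<lambda>x. ?p x > 0) (at_right \<mu>)"
    by (simp only: order_tendstoD(1))
  moreover have "eventually (\<lambda>x. x > \<mu>) (at_right \<mu>)"
    by (rule eventually_at_right_less)
  ultimately have "eventually (\<lambda>x. ?p x > 0 \<and> x > \<mu>) (at_right \<mu>)"
    by (rule eventually_conj)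
  then obtain x where x: "?p x > 0" "x > \<mu>"
    using eventually_happens[of _ "at_right \<mu>"] trivial_limit_at_right_real by blast
  then have "x \<le> graph_spectral_radius G"
    using mu by (intro dominated_spectral_lower[OF dom]) auto
  with x mu show False by simp
qed

section \<open>Numerical consequences of the bound on n\<close>

lemma quadratic_less_power2:
  assumes "t \<ge> 25"
  shows "5 * t ^ 2 + 10 * t + 4 < (2::nat) ^ t"
  using assms
proof (induction t rule: nat_induct_at_least)
  case (Suc t)
  have "25 * 25 \<le> t * t" using Suc.hyps by (intro mult_le_mono)
  then have "5 * (Suc t) ^ 2 + 10 * Suc t + 4 \<le> 2 * (5 * t ^ 2 + 10 * t + 4)"
    by (simp add: power2_eq_square)
  also have "\<dots> < 2 * 2 ^ t" using Suc.IH by simp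
  finally show ?case by simp
qed simp

lemma large_radius_bounds:
  fixes t n :: nat and N \<rho> :: real
  assumes t: "t \<ge> 1"
    and N: "N = max (1.27 * 10 ^ 7) (6.5025 * 2 ^ (2 * t + 1))"
    and n: "real n \<ge> N + 3 / 2 + 3 * sqrt (N - 7 / 4)"
    and rho: "sqrt (real n - 1) \<le> \<rho>"
  shows "2 * t + 1 < n" "\<rho> > 4 * real t ^ 2 + 10 * real t + 4 + 8 * real t ^ 2 / \<rho>"
    "\<rho> - 2 > 16 * real t" "real n - 1 \<le> \<rho>\<^sup>2"
proof -
  \<comment> \<open>Here 6.5025 * 2^(2 t + 1) = 13.005 * 4^t.\<close>
  have N1: "N \<ge> 12700000" and N2: "N \<ge> 13 * 4 ^ t"
    unfolding N by (simp_all add: power_mult power_add le_max_iff_disj)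
  have "sqrt (N - 7 / 4) \<ge> 0" using N1 by simp
  with n have nN: "real n - 1 \<ge> N" by linarith
  have "0 \<le> sqrt (real n - 1)" using nN N1 by simp
  then have rho0: "0 \<le> \<rho>" using rho by linarith
  show rho2: "real n - 1 \<le> \<rho>\<^sup>2"
    using real_le_rsqrt power_mono[OF rho, of 2] nN N1 by simp
  \<comment> \<open>3400^2 = 11560000 is below 12700000.\<close>
  have rho3: "\<rho> \<ge> 3400"
  proof (rule power2_le_imp_le)
    show "3400\<^sup>2 \<le> \<rho>\<^sup>2" using rho2 nN N1 by simp
  qed (fact rho0)
  have rho4: "\<rho> \<ge> 2 ^ t"
  proof (rule power2_le_imp_le)
    have "(2 ^ t)\<^sup>2 = (4::real) ^ t" by (simp add: power2_eq_square power_mult_distrib[symmetric])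
    also have "\<dots> \<le> 13 * 4 ^ t" by simp
    finally show "(2 ^ t)\<^sup>2 \<le> \<rho>\<^sup>2" using rho2 nN N2 by linarith
  qed (fact rho0)
  \<comment> \<open>At t = 25 the right side is 3379, just below 3400; from there on 2^t exceeds
    it.\<close>
  have main: "\<rho> > 5 * real t ^ 2 + 10 * real t + 4"
  proof (cases "t \<ge> 25")
    case True
    have "real (5 * t ^ 2 + 10 * t + 4) < real (2 ^ t)"
      using quadratic_less_power2[OF True] by (simp only: of_nat_less_iff)
    then show ?thesis using rho4 by simp
  next
    case False
    then have "real t \<le> 25" by simp
    moreover from this have "real t ^ 2 \<le> 25 ^ 2" by (intro power_mono) auto
    ultimately show ?thesis using rho3 by simp
  qed
  have "8 * real t ^ 2 / \<rho> \<le> 8 * real t ^ 2 / 8"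
    using rho3 by (intro divide_left_mono) auto
  then show "\<rho> > 4 * real t ^ 2 + 10 * real t + 4 + 8 * real t ^ 2 / \<rho>"
    using main by simp
  \<comment> \<open>This is 5 t^2 - 6 t + 9/5 >= 0, and the claim below amounts to 5 t^2 - 6 t + 2
    >= 0.\<close>
  have "0 \<le> 5 * (real t - 3 / 5)\<^sup>2" by simp
  then have "16 * real t + 2 \<le> 5 * real t ^ 2 + 10 * real t + 4"
    by (simp add: power2_eq_square algebra_simps)
  then show "\<rho> - 2 > 16 * real t" using main by linarith
  have "t < 2 ^ t" by (rule less_exp)
  also have "(2::nat) ^ t \<le> 4 ^ t" by (rule power_mono) auto
  finally have "real t < 4 ^ t" by (metis of_nat_less_iff of_nat_numeral of_nat_power)
  then have "2 * real t + 1 < real n" using nN N1 N2 by linarith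
  then show "2 * t + 1 < n" by linarith
qed

section \<open>Comparison with the candidate\<close>

lemma extremal_candidate_iso:
  fixes t n :: nat and N :: real
  defines "M \<equiv> fan_graph n (2 * t - 1)"
  assumes t: "t \<ge> 1"
    and N: "N = max (1.27 * 10 ^ 7) (6.5025 * 2 ^ (2 * t + 1))"
    and n: "real n \<ge> N + 3 / 2 + 3 * sqrt (N - 7 / 4)"
    and G: "simple_graph G" "nverts G = n" "outerplanar G"
    and bound: "\<And>X. matching G X \<Longrightarrow> card X \<le> t"
    and ge: "graph_spectral_radius M \<le> graph_spectral_radius G"
  shows "graph_iso G M"
proof -
  let ?\<rho> = "graph_spectral_radius G"
  have "2 * t + 1 < n"
    using large_radius_bounds(1)[OF t N n order_refl] .
  then have k: "2 * t - 1 < n" and n0: "real n > 1" using t by simp_all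
  have domM: "dominated_by M 0" unfolding M_def using k by (rule dominated_by_fan_graph)
  have nM: "nverts M = n" by (simp add: M_def)
  have "sqrt (real n - 1) \<le> graph_spectral_radius M"
    using dominated_spectral_radius_square[OF domM] n0 by (simp add: nM)
  then have rho: "sqrt (real n - 1) \<le> ?\<rho>" using ge by linarith
  note big = large_radius_bounds[OF t N n rho]
  have rho2: "?\<rho> > 2" using big(3) by (smt (verit) of_nat_0_le_iff)
  obtain S where S: "finite S" "card S \<le> 2 * t" "\<And>u v. {u, v} \<in> edges G \<Longrightarrow> u \<in> S \<or> v \<in> S"
    using matching_number_cover[OF G(1) bound] by blast
  obtain z where "z < nverts G" "nbrs G z = {..<nverts G} - {z}"
    using dominating_vertex[OF G(1) _ outerplanar_common_nbrs[OF G(3,1)] S] big rho2 G(2) n0 by auto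
  then have dom: "dominated_by G z" using G(1) by (simp add: dominated_by_def)
  define H where "H = delete_vertex G z"
  define H' where "H' = delete_vertex M 0"
  have forest: "linear_forest H"
    unfolding H_def by (rule linear_forest_delete_dominating[OF G(3) dom])
  have cardH: "card (edges H) \<le> 2 * (t - 1)"
    unfolding H_def using card_edges_delete_dominating[OF G(3) dom bound] big(1) G(2) by blast
  \<comment> \<open>For t = 1 no edge remains and the path is a single vertex, any one other than z;
    for t >= 2 edges exist and the forest lemma applies.\<close>
  have "\<exists>vs. distinct vs \<and> length vs = 2 * t - 1 \<and> set vs \<subseteq> {..<nverts G} - {z} \<and> edges H = walk_edges vs"
  proof (cases "t = 1")
    case True
    then have "edges H = {}"
      using cardH finite_edges[OF simple_delete_vertex[OF G(1)]] by (simp add: H_def)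
    moreover have "(if z = 0 then 1 else 0) < nverts G" "(if z = 0 then 1 else 0) \<noteq> z"
      using n0 G(2) by auto
    then obtain v where "v < nverts G" "v \<noteq> z" by blast
    ultimately show ?thesis using True by (intro exI[of _ "[v]"]) auto
  next
    case False
    with t have t2: "t \<ge> 2" by simp
    have cardH': "card (edges H') = 2 * (t - 1)"
      using card_delete_hub_edges[of n "2 * t - 1"] by (simp add: H'_def M_def)
    have "linear_forest H'"
      unfolding H'_def using linear_forest_delete_dominating[OF _ domM] outerplanar_fan_graph[OF k]
      by (simp add: M_def)
    then have W': "degree_square_sum H' = 4 * real (card (edges H')) - real (card (leaves H'))"
      using linear_forest_degree_squares by (simp add: degree_square_sum_def)
    have "card (leaves H') \<le> card {1, 2 * t - 1}"
      unfolding H'_def M_def by (intro card_mono leaves_delete_hub k) simp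
    also have "\<dots> \<le> 2" by (simp add: card_insert_if)
    finally have W'_ge: "degree_square_sum H' \<ge> 8 * (real t - 1) - 2"
      using W' cardH' t by (simp add: of_nat_diff)
    have W: "degree_square_sum H = 4 * real (card (edges H)) - real (card (leaves H))"
      using linear_forest_degree_squares[OF forest] by (simp add: degree_square_sum_def)
    have cH: "real (card (edges H)) \<le> 2 * (real t - 1)"
      using cardH t by (simp add: of_nat_diff) 
    have W_le: "degree_square_sum H \<le> 8 * (real t - 1)"
      using W cH by simp
    let ?W = "degree_square_sum H" and ?W' = "degree_square_sum H'"
      and ?e = "real (card (edges H))"
    have "(real n - 1) * ?\<rho>\<^sup>2 + 2 * (2 * (real t - 1)) * ?\<rho> + ?W' \<le> ?\<rho> ^ 4"
      using dominated_spectral_root[OF domM _ ge] rho2 cardH' t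
      unfolding H'_def[symmetric] by (simp add: nM of_nat_diff)
    also have "?\<rho> ^ 4 = ?\<rho> ^ 3 * ?\<rho>" by (simp add: power4_eq_xxxx power3_eq_cube)
    also have "\<dots> \<le> ((real n - 1) * ?\<rho> + 2 * ?e + ?W / (?\<rho> - 2)) * ?\<rho>"
      using dominated_spectral_upper[OF dom] forest n0 rho2 G(2)
      by (intro mult_right_mono) (auto simp: H_def)
    also have "\<dots> = (real n - 1) * ?\<rho>\<^sup>2 + 2 * ?e * ?\<rho> + (?W + 2 * ?W / (?\<rho> - 2))"
      using rho2 by (simp add: field_simps power2_eq_square)
    finally have cmp: "2 * (2 * (real t - 1) - ?e) * ?\<rho> + ?W' \<le> ?W + 2 * ?W / (?\<rho> - 2)"
      by (simp add: algebra_simps)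
    have "2 * ?W \<le> 2 * (8 * (real t - 1))"
      using W_le by (rule mult_left_mono) simp
    also have "\<dots> < 16 * real t" by simp
    also note big(3)
    finally have "2 * ?W < ?\<rho> - 2" .
    then have frac: "2 * ?W / (?\<rho> - 2) < 1"
      using rho2 by simp
    \<comment> \<open>A missing edge costs at least 2 \<rho>, while the squared degrees can gain at
      most 2 and the remainder less than 1.\<close>
    have eH: "card (edges H) = 2 * (t - 1)"
    proof (rule ccontr)
      assume "card (edges H) \<noteq> 2 * (t - 1)"
      then have "Suc (card (edges H)) \<le> 2 * (t - 1)" using cardH by simp
      then have "Suc (Suc (Suc (card (edges H)))) \<le> 2 * t" using t by simp
      then have "?e + 3 \<le> 2 * real t" by linarith
      then have "1 \<le> 2 * (real t - 1) - ?e" by (simp add: algebra_simps)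
      then have "2 * 1 * ?\<rho> \<le> 2 * (2 * (real t - 1) - ?e) * ?\<rho>"
        using rho2 by (intro mult_right_mono mult_left_mono) auto
      then show False using cmp frac W_le W'_ge big(3) t2 by linarith
    qed
    then have "?e = 2 * (real t - 1)" using t by (simp add: of_nat_diff)
    \<comment> \<open>With equal edge numbers the comparison reduces to the leaves: at most 2 in the
      candidate, plus a remainder below 1.\<close>
    then have "real (card (leaves H)) < 3"
      using cmp frac W W'_ge by simp
    then have "card (leaves H) \<le> 3" by simp
    moreover have "card (edges H) \<noteq> 0" using eH t2 by simp
    then have "edges H \<noteq> {}" by (metis card.empty)
    ultimately obtain vs where vs: "distinct vs" "length vs \<ge> 2" "edges H = walk_edges vs"
      using linear_forest_path[OF forest] by metis
    have "length vs = 2 * t - 1"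
      using eH card_walk_edges[OF vs(1)] vs(2,3) t2 by simp
    moreover have "set vs \<subseteq> {..<nverts G} - {z}"
    proof -
      have "\<Union>(edges H) \<subseteq> {..<nverts G} - {z}"
        using G(1) unfolding H_def simple_graph_def delete_vertex_simps by blast
      then show ?thesis using Union_walk_edges[OF vs(2)] vs(3) by simp
    qed
    ultimately show ?thesis using vs by blast
  qed
  then obtain vs where vs: "distinct vs" "length vs = 2 * t - 1" "set vs \<subseteq> {..<nverts G} - {z}"
    "edges H = walk_edges vs" by blast
  show ?thesis
    using dominated_path_iso_fan_graph[OF dom vs(1,3)] vs(2,4) G(2) by (simp only: H_def M_def)
qed

lemma finite_outerplanar_free_graphs: "finite (outerplanar_free_graphs n F)"
proof (rule finite_subset)
  show "outerplanar_free_graphs n F \<subseteq> (\<lambda>E. \<lparr>nverts = n, edges = E\<rparr>) ` Pow (Pow {..<n})"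
  proof
    fix G assume "G \<in> outerplanar_free_graphs n F"
    then have "G = \<lparr>nverts = n, edges = edges G\<rparr>" "edges G \<in> Pow (Pow {..<n})"
      by (auto simp: outerplanar_free_graphs_def simple_graph_def)
    then show "G \<in> (\<lambda>E. \<lparr>nverts = n, edges = E\<rparr>) ` Pow (Pow {..<n})" by blast
  qed
qed simp

text \<open>The comparison is used twice: for a maximiser, which exists by finiteness, it shows that
  the fan attains the maximum; for an arbitrary extremal graph it gives uniqueness.\<close>

lemma unique_extremal_fan_graph:
  fixes t n :: nat and N :: real
  assumes t: "t \<ge> 1"
    and N: "N = max (1.27 * 10 ^ 7) (6.5025 * 2 ^ (2 * t + 1))"
    and n: "real n \<ge> N + 3 / 2 + 3 * sqrt (N - 7 / 4)"
  shows "unique_extremal_OP n (copies (t + 1) (complete_graph 2)) (fan_graph n (2 * t - 1))"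
proof -
  let ?F = "copies (t + 1) (complete_graph 2)" and ?M = "fan_graph n (2 * t - 1)"
  let ?C = "outerplanar_free_graphs n ?F"
  have "2 * t + 1 < n"
    using large_radius_bounds(1)[OF t N n order_refl] .
  then have k: "2 * t - 1 < n" "n > 0" by simp_all
  have M: "?M \<in> ?C"
    using simple_fan_graph[OF k(1)] outerplanar_fan_graph[OF k(1)] fan_graph_matching[OF t]
      graph_free_copies_K2_iff[of ?M t]
    by (simp add: outerplanar_free_graphs_def)
  have iso: "graph_iso G ?M"
    if "G \<in> ?C" "graph_spectral_radius ?M \<le> graph_spectral_radius G" for G
  proof (rule extremal_candidate_iso[OF t N n])
    show "simple_graph G" "nverts G = n" "outerplanar G"
      using that(1) by (auto simp: outerplanar_free_graphs_def)
    then show "card X \<le> t" if "matching G X" for X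
      using graph_free_copies_K2_iff[of G t] \<open>G \<in> ?C\<close> that
      by (simp add: outerplanar_free_graphs_def)
  qed (fact that(2))
  have fin: "finite (graph_spectral_radius ` ?C)"
    by (intro finite_imageI finite_outerplanar_free_graphs)
  have le: "graph_spectral_radius G \<le> spex_OP n ?F" if "G \<in> ?C" for G
    unfolding spex_OP_def using fin that by simp
  have "spex_OP n ?F \<in> graph_spectral_radius ` ?C"
    unfolding spex_OP_def using fin M by (intro Max_in) auto
  then obtain G where G: "G \<in> ?C" "graph_spectral_radius G = spex_OP n ?F" by auto
  have "graph_iso G ?M"
    using G le[OF M] by (intro iso) auto
  then have "graph_spectral_radius G \<le> graph_spectral_radius ?M"
    by (rule graph_iso_spectral_radius_le)
      (use G(1) simple_fan_graph[OF k(1)] k(2) in \<open>auto simp: outerplanar_free_graphs_def\<close>)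
  with G(2) le[OF M] have eq: "graph_spectral_radius ?M = spex_OP n ?F" by simp
  show ?thesis
    unfolding unique_extremal_OP_def extremal_OP_def
    using M eq iso by auto
qed

theorem theorem3:
  fixes t n :: nat and N :: real
  assumes "t \<ge> 1"
    and "N = max (1.27 * 10 ^ 7) (6.5025 * 2 ^ (2 * t + 1))"
    and "real n \<ge> N + 3 / 2 + 3 * sqrt (N - 7 / 4)"
  shows "(t = 1 \<longrightarrow>
            unique_extremal_OP n (copies (t + 1) (complete_graph 2))
              (complete_bipartite 1 (n - 1))) \<and>
         (t \<ge> 2 \<longrightarrow>
            unique_extremal_OP n (copies (t + 1) (complete_graph 2))
              (graph_join (complete_graph 1) (H_OP n (2 * t - 1) 1)))"
proof -
  have "2 * t + 1 < n"
    using large_radius_bounds(1)[OF assms order_refl] .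
  then have "complete_bipartite 1 (n - 1) = fan_graph n 1"
    and "graph_join (complete_graph 1) (H_OP n (2 * t - 1) 1) = fan_graph n (2 * t - 1)"
    using assms(1) by (intro complete_bipartite_eq_fan_graph join_eq_fan_graph; linarith)+
  moreover have "t = 1 \<Longrightarrow> 2 * t - 1 = 1" by simp
  ultimately show ?thesis
    using unique_extremal_fan_graph[OF assms] by metis
qed

end
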